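(* Let $A$ and $B$ be finite commutative groups with $\gcd(|A|,|B|)>1$, and let $p_1,p_2,\dots,p_s$ be the (distinct) prime divisors of $\gcd(|A|,|B|)$. For $i=1,\dots,s$, let $A_i$ and $B_i$ be the (non-trivial) $p_i$-primary components of $A$ and $B$, respectively, and assume $$A_i=\mathbb{Z}_{q_{i,1}}\times\dots\times\mathbb{Z}_{q_{i,n_i}}\ \text{ with } q_{i,j}=p_i^{\alpha_{i,j}}>1,\qquad \alpha_{i,\max}:=\max_{1\le j\le n_i}\alpha_{i,j},$$ $$B_i=\mathbb{Z}_{r_{i,1}}\times\dots\times\mathbb{Z}_{r_{i,m_i}}\ \text{ with } r_{i,j}=p_i^{\beta_{i,j}}>1,\qquad \beta_{i,\max}:=\max_{1\le j\le m_i}\beta_{i,j}.$$ Then every function $f\colon A\to B$ of finite functional degree satisfies $$\mathrm{Fdeg}(f)\ \le\ \max_{1\le i\le s}\Bigl(\sum_{j=1}^{n_i}p_i^{\alpha_{i,j}}-n_i+(\beta_{i,\max}-1)(p_i-1)p_i^{\alpha_{i,\max}-1}\Bigr),$$ and this upper bound is best possible, i.e. it is attained by some function $f\colon A\to B$ of finite functional degree.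
   Context: Here $\mathbb{Z}_q=\mathbb{Z}/q\mathbb{Z}$. For commutative groups $A,B$, a map $f\colon A\to B$ and $g\in A$, the difference operator $\Delta_g$ is defined by $[\Delta_g f](x):=f(x+g)-f(x)$. Let $G$ be a generating subset of $A$. The functional degree $\mathrm{Fdeg}(f)$ is the smallest integer $m\ge 0$ such that $\Delta_{g_1}\Delta_{g_2}\cdots\Delta_{g_{m+1}}f\equiv 0$ for all $g_1,\dots,g_{m+1}\in G$, if such an $m$ exists, and $\mathrm{Fdeg}(f)=\infty$ otherwise; this value does not depend on the choice of the generating set $G$ (one may take $G=A$). In particular $\mathrm{Fdeg}(0)=0$. *)

theory Defs
  imports "HOL-Algebra.Product_Groups" "HOL-Computational_Algebra.Primes" "HOL-Library.Extended_Nat"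
begin

text \<open>Groups follow the multiplicative convention of HOL-Algebra, so \<open>f (x + g) - f x\<close> becomes
  \<open>f (x \<otimes> g) \<otimes> inv (f x)\<close> and the zero function becomes the function that is constantly \<open>\<one>\<close>.\<close>

definition diff_op ::
    "('a, 'm) monoid_scheme \<Rightarrow> ('b, 'n) monoid_scheme \<Rightarrow> 'a \<Rightarrow> ('a \<Rightarrow> 'b) \<Rightarrow> 'a \<Rightarrow> 'b" where
  "diff_op A B g f = (\<lambda>x. f (x \<otimes>\<^bsub>A\<^esub> g) \<otimes>\<^bsub>B\<^esub> inv\<^bsub>B\<^esub> (f x))"

text \<open>\<open>iter_diff_op A B [g\<^sub>1, \<dots>, g\<^sub>k] f\<close> is \<open>\<Delta>\<^bsub>g\<^sub>1\<^esub> \<dots> \<Delta>\<^bsub>g\<^sub>k\<^esub> f\<close>.\<close>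

definition iter_diff_op ::
    "('a, 'm) monoid_scheme \<Rightarrow> ('b, 'n) monoid_scheme \<Rightarrow> 'a list \<Rightarrow> ('a \<Rightarrow> 'b) \<Rightarrow> 'a \<Rightarrow> 'b" where
  "iter_diff_op A B gs f = foldr (diff_op A B) gs f"

definition diffs_vanish ::
    "('a, 'm) monoid_scheme \<Rightarrow> ('b, 'n) monoid_scheme \<Rightarrow> ('a \<Rightarrow> 'b) \<Rightarrow> nat \<Rightarrow> bool" where
  "diffs_vanish A B f k \<longleftrightarrow>
     (\<forall>gs. length gs = k \<and> set gs \<subseteq> carrier A \<longrightarrow>
        (\<forall>x\<in>carrier A. iter_diff_op A B gs f x = \<one>\<^bsub>B\<^esub>))"

text \<open>The functional degree does not depend on the chosen generating set of the domain; here it is all of \<open>A\<close>.\<close>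

definition fdeg ::
    "('a, 'm) monoid_scheme \<Rightarrow> ('b, 'n) monoid_scheme \<Rightarrow> ('a \<Rightarrow> 'b) \<Rightarrow> enat" where
  "fdeg A B f =
     (if \<exists>m. diffs_vanish A B f (m + 1)
      then enat (LEAST m. diffs_vanish A B f (m + 1))
      else \<infinity>)"

definition primary_component :: "('a, 'm) monoid_scheme \<Rightarrow> nat \<Rightarrow> ('a, 'm) monoid_scheme" where
  "primary_component G p =
     G\<lparr>carrier := {x \<in> carrier G. \<exists>k::nat. x [^]\<^bsub>G\<^esub> (p ^ k) = \<one>\<^bsub>G\<^esub>}\<rparr>"

end

theory Submission
  imports Defs "HOL-Algebra.Sylow" "HOL-Algebra.Multiplicative_Group"
    "HOL-Computational_Algebra.Polynomial_Factorial" "HOL-Number_Theory.Cong"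
begin

text \<open>
  Iterated differences are the action of products of elements \<open>g - 1\<close> of the group ring \<open>\<int>[A]\<close>, so
  the question is which power of the augmentation ideal annihilates a function.

  The primes separate. Raising \<open>f\<close> to a suitable power projects its values to the \<open>p\<close>-primary
  component of \<open>B\<close>, and finiteness of the degree then forces invariance under all elements of \<open>A\<close> of
  order prime to \<open>p\<close> (\<open>translation_invariant_if_coprime_order\<close>). What is left is a function from a
  \<open>p\<close>-group with cyclic factors of order \<open>p ^ \<alpha> j\<close> to integers modulo \<open>p ^ b\<close>. For primes that do not
  divide both orders it is constant.

  For a cyclic factor of order \<open>q = p\<^sup>a\<close> with generator \<open>g\<close> and \<open>X = g - 1\<close>, the powers of \<open>X\<close> become
  divisible by \<open>p\<close> at the exponent \<open>q\<close>, and by one more factor \<open>p\<close> after each further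
  \<open>(p - 1) p\<^sup>a\<^sup>-\<^sup>1\<close> factors \<open>X\<close>. This is exact: right before the threshold, \<open>X\<close> to the power
  \<open>q - 1 + k (p - 1) p\<^sup>a\<^sup>-\<^sup>1\<close> is congruent modulo \<open>p\<^sup>k\<^sup>+\<^sup>1\<close> to \<open>(- p)\<^sup>k\<close> times the sum of all group
  elements (\<open>power_augmentation_cong\<close>). With several factors, the worst way to spend differences is to use
  each direction \<open>q - 1\<close> times, which yields no factor \<open>p\<close>, and to put the remaining ones into a
  direction of largest order, where a factor \<open>p\<close> is most expensive. This gives the stated sum, as an
  upper bound by counting (\<open>dvd_idiffs_if_length_gt_bound\<close>). Conversely this choice of differences
  turns the indicator of a point of the \<open>p\<close>-group into \<open>\<plusminus> p ^ (b - 1)\<close> modulo \<open>p ^ b\<close>, because the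
  sum of the indicator over the whole group is 1 (\<open>sharp_idiffs_slice\<close>).

  The group ring itself does not occur in the formal argument. Values are moved to integers by coordinate maps, and
  \<open>\<int>[T]\<close> acts on integer functions by letting \<open>T\<close> translate along a chosen group element.
\<close>

(* The name denotes the order of a group, not the order of a root of a polynomial. *)
hide_const (open) Polynomial.order

section \<open>Powers of the augmentation generator of a cyclic group ring\<close>

lemma prime_dvd_binomial_power:
  fixes a b :: "'a::comm_ring_1" and p :: nat
  assumes "prime p"
  shows "of_nat p dvd (a + b) ^ p - (a ^ p + b ^ p)"
proof -
  have p: "p > 0" using assms prime_gt_0_nat by blast
  have "(a + b) ^ p = (\<Sum>k\<le>p. of_nat (p choose k) * a ^ k * b ^ (p - k))"
    by (rule binomial_ring)
  also have "{..p} = insert 0 (insert p {0<..<p})" using p by auto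
  also have "(\<Sum>k\<in>\<dots>. of_nat (p choose k) * a ^ k * b ^ (p - k)) =
      b ^ p + (a ^ p + (\<Sum>k\<in>{0<..<p}. of_nat (p choose k) * a ^ k * b ^ (p - k)))"
    using p by simp
  finally have eq: "(a + b) ^ p - (a ^ p + b ^ p) =
      (\<Sum>k\<in>{0<..<p}. of_nat (p choose k) * a ^ k * b ^ (p - k))" by simp
  have "of_nat p dvd (of_nat (p choose k) :: 'a)" if "k \<in> {0<..<p}" for k
  proof -
    have "p dvd p choose k" by (rule dvd_choose_prime) (use that assms in auto)
    then show ?thesis by (metis dvd_def of_nat_mult)
  qed
  then show ?thesis unfolding eq by (intro dvd_sum dvd_mult2) auto
qed

lemma dvd_power_diff_if_dvd_diff:
  fixes a b c :: "'a::comm_ring_1"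
  assumes "c dvd a - b" shows "c dvd a ^ n - b ^ n"
proof -
  have "a - b dvd a ^ n - b ^ n" 
    by (subst power_diff_sumr2) simp
  with assms show ?thesis by (rule dvd_trans)
qed

lemma prime_dvd_binomial_prime_power:
  fixes a b :: "'a::comm_ring_1" and p :: nat
  assumes "prime p"
  shows "of_nat p dvd (a + b) ^ (p ^ k) - (a ^ (p ^ k) + b ^ (p ^ k))"
proof (induction k)
  case (Suc k)
  let ?A = "a ^ (p ^ k)" and ?B = "b ^ (p ^ k)"
  have "of_nat p dvd ((a + b) ^ (p ^ k)) ^ p - (?A + ?B) ^ p"
    by (rule dvd_power_diff_if_dvd_diff) (rule Suc)
  moreover have "of_nat p dvd (?A + ?B) ^ p - (?A ^ p + ?B ^ p)"
    by (rule prime_dvd_binomial_power[OF assms])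
  ultimately have "of_nat p dvd (((a + b) ^ (p ^ k)) ^ p - (?A + ?B) ^ p) + ((?A + ?B) ^ p - (?A ^ p + ?B ^ p))"
    by (rule dvd_add)
  also have "\<dots> = ((a + b) ^ (p ^ k)) ^ p - (?A ^ p + ?B ^ p)" by simp
  finally show ?case by (simp only: power_Suc mult.commute[of p] power_mult)
qed simp

text \<open>This is the arithmetic heart of the matter. With \<open>X = T - 1\<close>, \<open>q = p\<^sup>a\<^sup>+\<^sup>1\<close> and
  \<open>N = 1 + T + \<dots> + T\<^sup>q\<^sup>-\<^sup>1\<close>, it evaluates the critical powers of the augmentation generator \<open>X\<close> of
  \<open>\<int>[T]/(T\<^sup>q - 1)\<close>, the group ring of the cyclic group of order \<open>q\<close>. Modulo \<open>p\<close> this ring is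
  \<open>\<F>\<^sub>p[X]/(X\<^sup>q)\<close>, whose socle is spanned by \<open>X\<^sup>q\<^sup>-\<^sup>1 = N\<close>; each further factor \<open>X\<close> to the power
  \<open>(p - 1) p\<^sup>a\<close> then costs exactly one factor \<open>- p\<close>.

  The reason is that \<open>U = X\<close> to the power \<open>(p - 1) p\<^sup>a\<close> is congruent modulo \<open>p\<close> to
  \<open>\<Phi> = 1 + Y + \<dots> + Y\<^sup>p\<^sup>-\<^sup>1\<close>, where \<open>Y = T\<close> to the power \<open>p\<^sup>a\<close>. As \<open>\<Phi>\<^sup>2 = p \<Phi>\<close> in the group ring,
  the powers of \<open>U = \<Phi> + p h\<close> have a closed form. Evaluating at \<open>T = 1\<close> gives \<open>h \<equiv> - 1\<close> modulo \<open>X\<close>,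
  and multiples of \<open>X\<close> do not matter because \<open>X\<close> annihilates \<open>N\<close>.\<close>

lemma power_augmentation_cong:
  fixes p a k :: nat and T :: "int poly"
  defines "T \<equiv> [:0, 1:]"
  assumes p: "prime p"
  defines "Q \<equiv> p ^ a" and "P \<equiv> of_nat p"
  shows "\<exists>u v. (T - 1) ^ (p * Q - 1 + k * ((p - 1) * Q)) =
     (-1) ^ k * P ^ k * (\<Sum>i<p * Q. T ^ i) + P ^ (k + 1) * u + (T ^ (p * Q) - 1) * v"
proof -
  define X where "X = T - 1"
  define Y where "Y = T ^ Q"
  define \<Phi> where "\<Phi> = (\<Sum>i<p. Y ^ i)"
  define U where "U = X ^ ((p - 1) * Q)"
  define N where "N = (\<Sum>i<p * Q. T ^ i)"
  define Z where "Z = T ^ (p * Q) - 1"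
  have pos: "p > 1" "Q > 0" using p prime_gt_1_nat[OF p] unfolding Q_def by auto
  have pQ: "p * Q = Q + (p - 1) * Q" using pos by (cases p) auto
  have primeP: "prime_elem P"
  proof -
    have "prime_elem [:int p:]" using p by (subst prime_elem_const_poly_iff) simp
    then show ?thesis by (simp add: P_def of_nat_poly)
  qed
  have Xe: "X = [:-1, 1:]" by (simp add: X_def T_def one_pCons)
  have root: "X dvd w" if "poly w 1 = 0" for w
    using that by (simp add: Xe poly_eq_0_iff_dvd)
  have notdvd: "\<not> P dvd X ^ i" for i
  proof
    assume "P dvd X ^ i"
    then have "P dvd X" using primeP prime_elem_dvd_power by blast
    then have "[:int p:] dvd [:-1, 1:]" by (simp add: P_def Xe of_nat_poly)
    then show False using pos by (auto simp: const_poly_dvd_iff coeff_pCons split: nat.splits)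
  qed
  have cancel: "P dvd w" if "P dvd X ^ i * w" for i w
    using that notdvd primeP prime_elem_dvd_multD by blast
  have frob: "\<exists>w. X ^ (p ^ j) = T ^ (p ^ j) - 1 + P * w" for j
  proof -
    have "P dvd (X + 1) ^ (p ^ j) - (X ^ (p ^ j) + 1 ^ (p ^ j))"
      unfolding P_def by (rule prime_dvd_binomial_prime_power[OF p])
    then obtain w where "T ^ (p ^ j) - (X ^ (p ^ j) + 1) = P * w" by (auto simp: X_def dvd_def)
    then show ?thesis by (intro exI[of _ "-w"]) (simp add: algebra_simps)
  qed
  obtain w where w: "X ^ Q = Y - 1 + P * w" using frob[of a] by (auto simp: Q_def Y_def)
  obtain w' where w': "X ^ (p * Q) = Z + P * w'"
    using frob[of "Suc a"] by (auto simp: Q_def Z_def)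
  have Yp: "Y ^ p = T ^ (p * Q)" by (simp add: Y_def mult.commute flip: power_mult)
  have YPhi: "(Y - 1) * \<Phi> = Z"
    unfolding \<Phi>_def Z_def by (simp add: Yp flip: power_diff_1_eq)
  have XN: "X * N = Z" unfolding N_def Z_def X_def by (simp flip: power_diff_1_eq)
  have XPhi: "X ^ Q * \<Phi> = Z + P * (w * \<Phi>)"
    using YPhi by (simp add: w algebra_simps)
  \<comment> \<open>Multiplying by a power of \<open>X\<close> turns \<open>U \<equiv> \<Phi>\<close> modulo \<open>p\<close> into the Frobenius congruences above;
    that power is cancelled since the prime \<open>p\<close> does not divide it.\<close>
  have "X ^ Q * (U - \<Phi>) = X ^ (p * Q) - X ^ Q * \<Phi>"
  proof -
    have "X ^ Q * U = X ^ (p * Q)" by (simp only: U_def pQ power_add)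
    then show ?thesis by (simp add: algebra_simps)
  qed
  also have "\<dots> = P * (w' - w * \<Phi>)" unfolding w' XPhi by (simp add: algebra_simps)
  finally have "P dvd U - \<Phi>" using cancel by (metis dvd_triv_left)
  then obtain h where "U - \<Phi> = P * h" by (auto simp: dvd_def)
  then have h: "U = \<Phi> + P * h" by (simp add: algebra_simps)
  have h1: "poly h 1 = -1"
  proof -
    have "poly U 1 = 0" using pos by (simp add: U_def Xe)
    moreover have "poly \<Phi> 1 = int p" by (simp add: \<Phi>_def Y_def T_def poly_sum)
    moreover have "poly P 1 = int p" by (simp add: P_def of_nat_poly)
    ultimately have "int p + int p * poly h 1 = 0" using h by (metis poly_add poly_mult)
    then have "int p * (poly h 1 + 1) = 0" by (simp add: algebra_simps)
    then show ?thesis using pos by simp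
  qed
  \<comment> \<open>\<open>Y\<close> acts on \<open>\<Phi>\<close> as the identity in the group ring, so \<open>\<Phi>\<close> acts on itself as \<open>p\<close>.\<close>
  have "\<exists>z. \<Phi> * \<Phi> = P * \<Phi> + Z * z"
  proof -
    have "Y - 1 dvd (\<Sum>i<p. Y ^ i - 1)"
      by (intro dvd_sum) (metis dvd_triv_left power_diff_1_eq)
    then obtain z where "(\<Sum>i<p. Y ^ i - 1) = (Y - 1) * z" by (auto simp: dvd_def)
    then have "\<Phi> - P = (Y - 1) * z" by (simp add: \<Phi>_def P_def sum_subtractf)
    then have "(\<Phi> - P) * \<Phi> = ((Y - 1) * \<Phi>) * z" by simp
    then have "(\<Phi> - P) * \<Phi> = Z * z" by (simp only: YPhi)
    then show ?thesis by (intro exI[of _ z]) (simp add: algebra_simps)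
  qed
  then obtain z where z: "\<Phi> * \<Phi> = P * \<Phi> + Z * z" by blast
  have pow: "\<exists>v. U ^ (k + 1) =
     P ^ (k + 1) * h ^ (k + 1) + P ^ k * (\<Phi> * ((1 + h) ^ (k + 1) - h ^ (k + 1))) + Z * v" for k
  proof (induction k)
    case 0
    then show ?case by (intro exI[of _ 0]) (simp add: h)
  next
    case (Suc k)
    then obtain v where v: "U ^ (k + 1) =
     P ^ (k + 1) * h ^ (k + 1) + P ^ k * (\<Phi> * ((1 + h) ^ (k + 1) - h ^ (k + 1))) + Z * v" by blast
    let ?c = "(1 + h) ^ (k + 1)" and ?d = "h ^ (k + 1)" and ?e = "P ^ k"
    have "U ^ (Suc k + 1) = (\<Phi> + P * h) * (?e * P * ?d + ?e * (\<Phi> * (?c - ?d)) + Z * v)"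
      using v h by (simp add: mult.commute)
    also have "\<dots> = ?e * P * P * (h * ?d) + ?e * (P * \<Phi> * (h * (?c - ?d)) + P * \<Phi> * ?d + (\<Phi> * \<Phi>) * (?c - ?d)) + Z * (v * U)"
      by (simp add: h algebra_simps)
    also have "\<dots> = ?e * P * P * (h * ?d) + ?e * P * (\<Phi> * ((1 + h) * ?c - h * ?d))
       + Z * (v * U + ?e * z * (?c - ?d))"
      unfolding z by (simp add: algebra_simps)
    finally show ?case by (intro exI[of _ "v * U + ?e * z * (?c - ?d)"]) (simp add: mult_ac)
  qed
  then obtain v where v: "U ^ (k + 1) =
     P ^ (k + 1) * h ^ (k + 1) + P ^ k * (\<Phi> * ((1 + h) ^ (k + 1) - h ^ (k + 1))) + Z * v" by blast
  \<comment> \<open>Modulo \<open>X\<close> the factor next to \<open>\<Phi>\<close> is \<open>0 - (- 1)\<^sup>k\<^sup>+\<^sup>1\<close>.\<close>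
  have "poly ((1 + h) ^ (k + 1) - h ^ (k + 1) - (-1) ^ k) 1 = 0"
    by (simp add: h1)
  from root[OF this] obtain t where t: "(1 + h) ^ (k + 1) - h ^ (k + 1) = (-1) ^ k + X * t"
    by (auto simp: dvd_def algebra_simps)
  have XQ: "X ^ Q = X * X ^ (Q - 1)" using pos by (metis Suc_diff_1 power_Suc)
  have "X ^ 1 * (X ^ (Q - 1) * \<Phi> - N) = P * (w * \<Phi>)"
    using XPhi XN by (simp add: XQ algebra_simps)
  then have "P dvd X ^ (Q - 1) * \<Phi> - N" using cancel by (metis dvd_triv_left)
  then obtain y where y: "X ^ (Q - 1) * \<Phi> = N + P * y" by (auto simp: dvd_def algebra_simps)
  have "p * Q - 1 + k * ((p - 1) * Q) = (Q - 1) + ((p - 1) * Q) * (k + 1)"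
  proof -
    have "Q + R - 1 + k * R = Q - 1 + R * (k + 1)" for R
      using pos(2) by (cases Q) (simp_all add: algebra_simps)
    then show ?thesis by (simp only: pQ)
  qed
  then have "X ^ (p * Q - 1 + k * ((p - 1) * Q)) = X ^ (Q - 1) * U ^ (k + 1)"
    by (simp only: power_add power_mult U_def)
  also have "\<dots> = P ^ (k + 1) * (X ^ (Q - 1) * h ^ (k + 1))
       + P ^ k * ((X ^ (Q - 1) * \<Phi>) * (-1) ^ k + (X ^ Q * \<Phi>) * t) + Z * (v * X ^ (Q - 1))"
    unfolding v t XQ by (simp add: algebra_simps)
  also have "\<dots> = (-1) ^ k * P ^ k * N
       + P ^ (k + 1) * (X ^ (Q - 1) * h ^ (k + 1) + (-1) ^ k * y + w * \<Phi> * t)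
       + Z * (v * X ^ (Q - 1) + P ^ k * t)"
    unfolding XPhi y by (simp add: algebra_simps)
  finally show ?thesis unfolding X_def N_def Z_def by blast
qed

section \<open>Differences of integer-valued functions\<close>

text \<open>Differences of integer-valued functions. Integer lifts of functions into a cyclic group can be
  divided by a power of \<open>p\<close> once all their values are divisible by it, which functions into a finite
  group do not permit.\<close>

definition idiff :: "('a, 'm) monoid_scheme \<Rightarrow> 'a \<Rightarrow> ('a \<Rightarrow> int) \<Rightarrow> 'a \<Rightarrow> int" where
  "idiff G g F = (\<lambda>x. F (x \<otimes>\<^bsub>G\<^esub> g) - F x)"

definition idiffs :: "('a, 'm) monoid_scheme \<Rightarrow> 'a list \<Rightarrow> ('a \<Rightarrow> int) \<Rightarrow> 'a \<Rightarrow> int" where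
  "idiffs G gs F = foldr (idiff G) gs F"

lemma idiffs_Nil [simp]: "idiffs G [] F = F"
  and idiffs_Cons: "idiffs G (g # gs) F = idiff G g (idiffs G gs F)"
  and idiffs_append: "idiffs G (gs @ hs) F = idiffs G gs (idiffs G hs F)"
  by (simp_all add: idiffs_def)

context comm_group
begin

lemma idiffs_dvd:
  assumes "\<And>x. x \<in> carrier G \<Longrightarrow> c dvd F x" "set gs \<subseteq> carrier G" "x \<in> carrier G"
  shows "c dvd idiffs G gs F x"
  using assms(2,3)
proof (induction gs arbitrary: x)
  case (Cons g gs)
  then have "c dvd idiffs G gs F (x \<otimes> g)" "c dvd idiffs G gs F x" by auto
  then show ?case by (simp add: idiffs_Cons idiff_def)
qed (use assms in simp)

lemma idiffs_minus:
  "idiffs G gs (\<lambda>x. F x - F' x) x = idiffs G gs F x - idiffs G gs F' x"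
  by (induction gs arbitrary: x) (simp_all add: idiffs_Cons idiff_def)

lemma idiffs_mult_left:
  "idiffs G gs (\<lambda>x. c * F x) x = c * idiffs G gs F x"
  by (induction gs arbitrary: x) (simp_all add: idiffs_Cons idiff_def right_diff_distrib)

lemma idiffs_cong_mod:
  assumes "\<And>x. x \<in> carrier G \<Longrightarrow> [F x = F' x] (mod c)" "set gs \<subseteq> carrier G" "x \<in> carrier G"
  shows "[idiffs G gs F x = idiffs G gs F' x] (mod c)"
proof -
  have "c dvd idiffs G gs (\<lambda>x. F x - F' x) x"
    using assms by (intro idiffs_dvd) (auto simp: cong_iff_dvd_diff)
  then show ?thesis by (simp add: idiffs_minus cong_iff_dvd_diff)
qed

lemma idiffs_cong:
  assumes "\<And>x. x \<in> carrier G \<Longrightarrow> F x = F' x" "set gs \<subseteq> carrier G" "x \<in> carrier G"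
  shows "idiffs G gs F x = idiffs G gs F' x"
  using idiffs_cong_mod[of F F' 0 gs x] assms by (simp add: cong_def)

lemma idiffs_translate:
  assumes "set gs \<subseteq> carrier G" "x \<in> carrier G" "y \<in> carrier G"
  shows "idiffs G gs (\<lambda>x. F (x \<otimes> y)) x = idiffs G gs F (x \<otimes> y)"
  using assms
proof (induction gs arbitrary: x)
  case (Cons g gs)
  then have "x \<otimes> g \<otimes> y = x \<otimes> y \<otimes> g" by (simp add: m_ac)
  with Cons show ?case by (simp add: idiffs_Cons idiff_def)
qed simp

lemma idiff_idiffs:
  assumes "set gs \<subseteq> carrier G" "x \<in> carrier G" "g \<in> carrier G"
  shows "idiff G g (idiffs G gs F) x = idiffs G gs (idiff G g F) x"
  using idiffs_translate[OF assms, of F] by (simp add: idiff_def idiffs_minus)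

lemma idiffs_mset:
  assumes "mset gs = mset hs" "set gs \<subseteq> carrier G" "x \<in> carrier G"
  shows "idiffs G gs F x = idiffs G hs F x"
  using assms
proof (induction gs arbitrary: hs x)
  case (Cons g gs)
  then have "g \<in> set hs" by (metis list.set_intros(1) mset_eq_setD)
  then obtain us vs where hs: "hs = us @ g # vs" by (meson split_list)
  have m: "mset gs = mset (us @ vs)" using Cons.prems(1) by (simp add: hs)
  have sub: "set us \<subseteq> carrier G" "set vs \<subseteq> carrier G" "g \<in> carrier G"
    using Cons.prems(1,2) mset_eq_setD[OF Cons.prems(1)] hs by auto
  have "idiffs G (g # gs) F x = idiff G g (idiffs G (us @ vs) F) x"
    using Cons.IH[OF m] Cons.prems by (simp add: idiffs_Cons idiff_def)
  also have "\<dots> = idiffs G hs F x"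
    using sub Cons.prems by (simp add: hs idiffs_append idiffs_Cons idiff_idiffs)
  finally show ?case .
qed simp

lemma idiffs_eq_0_if_periodic:
  assumes "\<And>x. x \<in> carrier G \<Longrightarrow> F (x \<otimes> g) = F x" "g \<in> set gs" "set gs \<subseteq> carrier G" "x \<in> carrier G"
  shows "idiffs G gs F x = 0"
proof -
  obtain us vs where gs: "gs = us @ g # vs" using assms(2) by (meson split_list)
  have "idiffs G gs F x = idiffs G (us @ vs @ [g]) F x"
    using assms by (intro idiffs_mset) (auto simp: gs)
  also have "\<dots> = idiffs G (us @ vs) (idiffs G [g] F) x" by (simp flip: idiffs_append)
  also have "\<dots> = 0"
    using assms gs idiffs_dvd[of 0 "idiffs G [g] F" "us @ vs" x]
    by (simp add: idiffs_Cons idiff_def)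
  finally show ?thesis .
qed

text \<open>It suffices to difference along a generating set: for fixed further differences, the \<open>h\<close> for
  which differencing along \<open>h\<close> annihilates \<open>F\<close> modulo \<open>c\<close> form a subgroup, because
  \<open>\<Delta>\<^bsub>gh\<^esub> F\<close> is the sum of \<open>\<Delta>\<^bsub>g\<^esub> F\<close> and a translate of \<open>\<Delta>\<^bsub>h\<^esub> F\<close>.\<close>

lemma idiffs_dvd_generate:
  assumes gen: "generate G S = carrier G" and S: "S \<subseteq> carrier G"
    and "\<And>gs x. length gs = k \<Longrightarrow> set gs \<subseteq> S \<Longrightarrow> x \<in> carrier G \<Longrightarrow> c dvd idiffs G gs F x"
    and "length gs = k" "set gs \<subseteq> carrier G" "x \<in> carrier G"
  shows "c dvd idiffs G gs F x"
  using assms(3-6)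
proof (induction k arbitrary: F gs x)
  case (Suc k)
  obtain hs g where gs: "gs = hs @ [g]" using Suc.prems(2) by (metis length_Suc_conv_rev)
  define good where "good h \<longleftrightarrow> (\<forall>x\<in>carrier G. c dvd idiffs G hs (idiff G h F) x)" for h
  have hs: "length hs = k" "set hs \<subseteq> carrier G" and g: "g \<in> carrier G"
    using Suc.prems gs by auto
  have "good h" if "h \<in> generate G S" for h
    using that
  proof (induction rule: generate.induct)
    case one
    have "idiffs G hs (idiff G \<one> F) y = idiffs G hs (\<lambda>x. 0) y" if "y \<in> carrier G" for y
      using hs that by (intro idiffs_cong) (auto simp: idiff_def)
    moreover have "c dvd idiffs G hs (\<lambda>x. 0) y" if "y \<in> carrier G" for y
      using that hs by (intro idiffs_dvd) auto
    ultimately show ?case by (simp add: good_def)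
  next
    case (incl h)
    have "c dvd idiffs G hs (idiff G h F) y" if "y \<in> carrier G" for y
    proof (rule Suc.IH)
      fix us z assume "length us = k" "set us \<subseteq> S" "z \<in> carrier G"
      then show "c dvd idiffs G us (idiff G h F) z"
        using Suc.prems(1)[of "us @ [h]" z] incl by (simp add: idiffs_append idiffs_Cons)
    qed (use hs that in auto)
    then show ?case by (simp add: good_def)
  next
    case (inv h)
    have h: "h \<in> carrier G" using inv S by auto
    have g: "c dvd idiffs G hs (idiff G h F) y" if "y \<in> carrier G" for y
    proof (rule Suc.IH)
      fix us z assume "length us = k" "set us \<subseteq> S" "z \<in> carrier G"
      then show "c dvd idiffs G us (idiff G h F) z"
        using Suc.prems(1)[of "us @ [h]" z] inv by (simp add: idiffs_append idiffs_Cons)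
    qed (use hs that in auto)
    have "c dvd idiffs G hs (idiff G (inv h) F) y" if y: "y \<in> carrier G" for y
    proof -
      have "idiffs G hs (idiff G (inv h) F) y =
          idiffs G hs (\<lambda>x. - 1 * idiff G h F (x \<otimes> inv h)) y"
        using hs y h by (intro idiffs_cong) (auto simp: idiff_def m_assoc)
      also have "\<dots> = - 1 * idiffs G hs (idiff G h F) (y \<otimes> inv h)"
        unfolding idiffs_mult_left using hs y h by (simp add: idiffs_translate)
      finally show ?thesis using g[of "y \<otimes> inv h"] y h by simp
    qed
    then show ?case by (simp add: good_def)
  next
    case (eng h1 h2)
    have h: "h1 \<in> carrier G" "h2 \<in> carrier G" using eng gen by auto
    have "c dvd idiffs G hs (idiff G (h1 \<otimes> h2) F) y" if y: "y \<in> carrier G" for y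
    proof -
      have "idiffs G hs (idiff G (h1 \<otimes> h2) F) y =
          idiffs G hs (\<lambda>x. idiff G h1 F x - (- 1 * idiff G h2 F (x \<otimes> h1))) y"
        using hs y h by (intro idiffs_cong) (auto simp: idiff_def m_assoc)
      also have "\<dots> = idiffs G hs (idiff G h1 F) y - (- 1 * idiffs G hs (idiff G h2 F) (y \<otimes> h1))"
        unfolding idiffs_mult_left idiffs_minus using hs y h by (simp add: idiffs_translate)
      finally show ?thesis using eng.IH y h by (simp add: good_def)
    qed
    then show ?case by (simp add: good_def)
  qed
  then have "good g" using g gen by simp
  then show ?case using Suc.prems by (simp add: gs good_def idiffs_append idiffs_Cons)
qed simp

end

text \<open>\<open>shift_poly G g P\<close> is the polynomial \<open>P\<close> evaluated at the operator that translates a function by \<open>g\<close>.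
  Through it, congruences in \<open>\<int>[T]\<close> modulo \<open>T\<^sup>q - 1\<close> become statements about iterated
  differences along an element whose \<open>q\<close>-th power is trivial.\<close>

definition shift_poly :: "('a, 'm) monoid_scheme \<Rightarrow> 'a \<Rightarrow> int poly \<Rightarrow> ('a \<Rightarrow> int) \<Rightarrow> 'a \<Rightarrow> int" where
  "shift_poly G g P F x = (\<Sum>i\<le>degree P. coeff P i * F (x \<otimes>\<^bsub>G\<^esub> g [^]\<^bsub>G\<^esub> i))"

context comm_group
begin

lemma shift_poly_altdef:
  assumes "degree P \<le> n"
  shows "shift_poly G g P F x = (\<Sum>i\<le>n. coeff P i * F (x \<otimes> g [^] i))"
  unfolding shift_poly_def using assms
  by (intro sum.mono_neutral_left) (auto simp: coeff_eq_0)

lemma shift_poly_add: "shift_poly G g (P + Q) F x = shift_poly G g P F x + shift_poly G g Q F x"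
proof -
  let ?n = "max (degree P) (degree Q)"
  have "degree (P + Q) \<le> ?n" by (rule degree_add_le_max)
  then show ?thesis
    by (simp add: shift_poly_altdef[of _ ?n] sum.distrib algebra_simps)
qed

lemma shift_poly_smult: "shift_poly G g (smult c P) F x = c * shift_poly G g P F x"
  by (simp add: shift_poly_altdef[OF degree_smult_le] shift_poly_def sum_distrib_left mult_ac)

lemma shift_poly_minus: "shift_poly G g (P - Q) F x = shift_poly G g P F x - shift_poly G g Q F x"
  using shift_poly_add[of g P "smult (-1) Q" F x] shift_poly_smult[of g "-1" Q F x] by simp

lemma shift_poly_0 [simp]: "shift_poly G g 0 F x = 0"
  by (simp add: shift_poly_def)

lemma shift_poly_sum:
  "shift_poly G g (\<Sum>i\<in>I. P i) F x = (\<Sum>i\<in>I. shift_poly G g (P i) F x)"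
  by (induction I rule: infinite_finite_induct) (simp_all add: shift_poly_add)

lemma shift_poly_pCons:
  assumes "x \<in> carrier G" "g \<in> carrier G"
  shows "shift_poly G g (pCons c P) F x = c * F x + shift_poly G g P F (x \<otimes> g)"
proof -
  have "shift_poly G g (pCons c P) F x =
      (\<Sum>i\<le>Suc (degree P). coeff (pCons c P) i * F (x \<otimes> g [^] i))"
    by (intro shift_poly_altdef degree_pCons_le)
  also have "\<dots> = c * F x + (\<Sum>i\<le>degree P. coeff P i * F (x \<otimes> g [^] Suc i))"
    using assms by (subst sum.atMost_Suc_shift) simp
  also have "(\<Sum>i\<le>degree P. coeff P i * F (x \<otimes> g [^] Suc i)) = shift_poly G g P F (x \<otimes> g)"
    using assms unfolding shift_poly_def 
    by (intro sum.cong) (simp_all add: m_ac nat_pow_closed)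
  finally show ?thesis .
qed

lemma shift_poly_X_power_mult:
  assumes "x \<in> carrier G" "g \<in> carrier G"
  shows "shift_poly G g ([:0, 1:] ^ i * P) F x = shift_poly G g P F (x \<otimes> g [^] i)"
  using assms(1)
proof (induction i arbitrary: x)
  case (Suc i)
  have "[:0, 1:] ^ Suc i * P = pCons 0 ([:0, 1:] ^ i * P)" by simp
  then have "shift_poly G g ([:0, 1:] ^ Suc i * P) F x = shift_poly G g P F (x \<otimes> g \<otimes> g [^] i)"
    using Suc assms by (simp only: shift_poly_pCons) simp
  also have "x \<otimes> g \<otimes> g [^] i = x \<otimes> g [^] Suc i" using Suc.prems assms(2) by (simp add: m_ac)
  finally show ?case .
qed (use assms in simp)

lemma shift_poly_X_power:
  assumes "x \<in> carrier G" "g \<in> carrier G"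
  shows "shift_poly G g ([:0, 1:] ^ i) F x = F (x \<otimes> g [^] i)"
  using shift_poly_X_power_mult[OF assms, of i 1 F] assms by (simp add: shift_poly_def)

lemma idiffs_replicate:
  assumes "x \<in> carrier G" "g \<in> carrier G"
  shows "idiffs G (replicate d g) F x = shift_poly G g (([:0, 1:] - 1) ^ d) F x"
  using assms(1)
proof (induction d arbitrary: x)
  case 0
  then show ?case using assms by (simp add: shift_poly_def)
next
  case (Suc d)
  let ?P = "([:0, 1:] - 1) ^ d :: int poly"
  have "([:0, 1:] - 1) ^ Suc d = pCons 0 ?P - ?P" by (simp add: left_diff_distrib)
  then have "shift_poly G g (([:0, 1:] - 1) ^ Suc d) F x =
      shift_poly G g ?P F (x \<otimes> g) - shift_poly G g ?P F x"
    using Suc.prems assms(2)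
    by (simp add: shift_poly_minus shift_poly_pCons)
  with Suc assms show ?case by (simp add: idiffs_Cons idiff_def)
qed

lemma idiffs_replicate_cong:
  fixes p a k :: nat
  assumes p: "prime p" and g: "g \<in> carrier G" "g [^] (p * p ^ a) = \<one>" and x: "x \<in> carrier G"
  shows "[idiffs G (replicate (p * p ^ a - 1 + k * ((p - 1) * p ^ a)) g) F x
          = (-1) ^ k * int p ^ k * (\<Sum>i<p * p ^ a. F (x \<otimes> g [^] i))] (mod int p ^ (k + 1))"
proof -
  let ?T = "[:0, 1:] :: int poly"
  obtain u v where "(?T - 1) ^ (p * p ^ a - 1 + k * ((p - 1) * p ^ a)) =
     (-1) ^ k * of_nat p ^ k * (\<Sum>i<p * p ^ a. ?T ^ i) + of_nat p ^ (k + 1) * u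
     + (?T ^ (p * p ^ a) - 1) * v"
    using power_augmentation_cong[OF p, of a k] by blast
  also have "\<dots> = smult ((-1) ^ k * int p ^ k) (\<Sum>i<p * p ^ a. ?T ^ i) + smult (int p ^ (k + 1)) u
     + (?T ^ (p * p ^ a) * v - v)"
  proof -
    have c: "(-1) ^ k = [:(-1) ^ k:]" "of_nat p ^ n = ([:int p ^ n:] :: int poly)" for n
      by (simp_all add: of_nat_poly poly_const_pow one_pCons)
    show ?thesis unfolding c by (simp add: algebra_simps)
  qed
  finally have "idiffs G (replicate (p * p ^ a - 1 + k * ((p - 1) * p ^ a)) g) F x =
      (-1) ^ k * int p ^ k * (\<Sum>i<p * p ^ a. F (x \<otimes> g [^] i)) +
      int p ^ (k + 1) * shift_poly G g u F x"
    using g x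
    by (simp only: idiffs_replicate shift_poly_add shift_poly_minus shift_poly_smult
      shift_poly_sum shift_poly_X_power shift_poly_X_power_mult) simp
  then show ?thesis by (simp add: cong_iff_dvd_diff)
qed

text \<open>One more difference than in \<open>idiffs_replicate_cong\<close> annihilates the sum over the
  translates by powers of \<open>g\<close>, since that sum is invariant under \<open>g\<close>.\<close>

lemma dvd_idiffs_replicate:
  fixes p a k :: nat
  assumes p: "prime p" and g: "g \<in> carrier G" "g [^] (p * p ^ a) = \<one>" and x: "x \<in> carrier G"
    and d: "d \<ge> p * p ^ a + k * ((p - 1) * p ^ a)"
  shows "int p ^ (k + 1) dvd idiffs G (replicate d g) F x"
proof -
  let ?q = "p * p ^ a"
  define d0 where "d0 = ?q - 1 + k * ((p - 1) * p ^ a)"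
  have q: "?q > 0" using p prime_gt_0_nat by simp
  have "d = (d - Suc d0) + Suc d0" using d q by (simp add: d0_def)
  then have d: "replicate d g = replicate (d - Suc d0) g @ (g # replicate d0 g)"
    by (metis replicate_Suc replicate_add)
  have "int p ^ (k + 1) dvd idiffs G (g # replicate d0 g) F y" if y: "y \<in> carrier G" for y
  proof -
    have "(\<Sum>i<?q. F (y \<otimes> g \<otimes> g [^] i)) = (\<Sum>i<?q. F (y \<otimes> g [^] Suc i))"
      using y g(1) by (intro sum.cong) (simp_all add: m_ac)
    also have "\<dots> = (\<Sum>i<?q. F (y \<otimes> g [^] i))"
      using sum.lessThan_Suc[of "\<lambda>i. F (y \<otimes> g [^] i)" ?q]
        sum.lessThan_Suc_shift[of "\<lambda>i. F (y \<otimes> g [^] i)" ?q] g by simp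
    finally have sums: "(\<Sum>i<?q. F (y \<otimes> g \<otimes> g [^] i)) = (\<Sum>i<?q. F (y \<otimes> g [^] i))" .
    have "[idiffs G (replicate d0 g) F (y \<otimes> g) = idiffs G (replicate d0 g) F y] (mod int p ^ (k + 1))"
      using cong_trans[OF idiffs_replicate_cong[OF p g, of "y \<otimes> g" k F, unfolded sums]
          cong_sym[OF idiffs_replicate_cong[OF p g y, of k F]]] y g
      by (simp add: d0_def)
    then show ?thesis by (simp add: idiffs_Cons idiff_def cong_iff_dvd_diff)
  qed
  then show ?thesis unfolding d idiffs_append using g x
    by (intro idiffs_dvd[where F = "idiffs G (g # replicate d0 g) F"]) auto
qed

end

section \<open>Coordinates on a primary component\<close>

lemma (in group) eq_one_if_coprime_pow:
  assumes "x \<in> carrier G" "x [^] (k::nat) = \<one>" "x [^] (l::nat) = \<one>" "coprime k l"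
  shows "x = \<one>"
proof -
  have "ord x dvd k" "ord x dvd l" using assms pow_eq_id by auto
  then have "ord x dvd 1" using assms(4) by (metis coprime_common_divisor_nat nat_dvd_1_iff_1)
  then have "ord x = 1" by simp
  then show ?thesis using assms(1) ord_eq_1 by blast
qed

text \<open>Coordinates on the \<open>p\<close>-primary component, extended to the whole group: \<open>\<kappa> j\<close> first projects to the
  component and then reads off the \<open>j\<close>-th cyclic factor, represented by its least nonnegative
  residue, and \<open>e j\<close> is the \<open>j\<close>-th unit vector. The last assumption says that the common kernel of
  the coordinates consists of the elements of order prime to \<open>p\<close>. Having the \<open>\<kappa> j\<close> defined on all
  of \<open>G\<close> avoids splitting \<open>G\<close> into its primary components.\<close>

locale primary_coordinates = comm_group G for G (structure) +
  fixes p :: nat and J :: "'i set" and \<alpha> :: "'i \<Rightarrow> nat"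
    and e :: "'i \<Rightarrow> 'a" and \<kappa> :: "'i \<Rightarrow> 'a \<Rightarrow> int"
  assumes prime: "prime p" and finite_J: "finite J"
    and \<alpha>_pos: "j \<in> J \<Longrightarrow> \<alpha> j > 0"
    and e_closed: "j \<in> J \<Longrightarrow> e j \<in> carrier G"
    and e_pow: "j \<in> J \<Longrightarrow> e j [^] (p ^ \<alpha> j) = \<one>"
    and \<kappa>_range: "j \<in> J \<Longrightarrow> x \<in> carrier G \<Longrightarrow> \<kappa> j x \<in> {0..<int p ^ \<alpha> j}"
    and \<kappa>_mult: "j \<in> J \<Longrightarrow> x \<in> carrier G \<Longrightarrow> y \<in> carrier G \<Longrightarrow>
       \<kappa> j (x \<otimes> y) = (\<kappa> j x + \<kappa> j y) mod int p ^ \<alpha> j"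
    and \<kappa>_e: "i \<in> J \<Longrightarrow> j \<in> J \<Longrightarrow> \<kappa> j (e i) = (if i = j then 1 else 0)"
    and \<kappa>_ker: "x \<in> carrier G \<Longrightarrow> (\<And>j. j \<in> J \<Longrightarrow> \<kappa> j x = 0) \<Longrightarrow> \<exists>l::nat. \<not> p dvd l \<and> x [^] l = \<one>"
begin

definition "ker = {x \<in> carrier G. \<forall>j\<in>J. \<kappa> j x = 0}"

lemma \<kappa>_mod: "j \<in> J \<Longrightarrow> x \<in> carrier G \<Longrightarrow> \<kappa> j x mod int p ^ \<alpha> j = \<kappa> j x"
  using \<kappa>_range[of j x] by simp

lemma \<kappa>_one: "j \<in> J \<Longrightarrow> \<kappa> j \<one> = 0"
proof -
  assume j: "j \<in> J"
  have "[\<kappa> j \<one> + 0 = \<kappa> j \<one> + \<kappa> j \<one>] (mod int p ^ \<alpha> j)"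
    using \<kappa>_mult[OF j, of \<one> \<one>] \<kappa>_mod[OF j, of \<one>] by (simp add: cong_def)
  then have "[0 = \<kappa> j \<one>] (mod int p ^ \<alpha> j)" using cong_add_lcancel by blast
  then show ?thesis using \<kappa>_mod[OF j, of \<one>] by (simp add: cong_def)
qed

lemma \<kappa>_pow:
  assumes j: "j \<in> J" and x: "x \<in> carrier G"
  shows "\<kappa> j (x [^] (n::nat)) = (int n * \<kappa> j x) mod int p ^ \<alpha> j"
proof (induction n)
  case (Suc n)
  then show ?case using \<kappa>_mult[OF j, of "x [^] n" x] x by (simp add: mod_simps algebra_simps)
qed (use \<kappa>_one[OF j] in simp)

lemma \<kappa>_inv:
  assumes j: "j \<in> J" and x: "x \<in> carrier G"
  shows "\<kappa> j (inv x) = (- \<kappa> j x) mod int p ^ \<alpha> j"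
proof -
  have "[\<kappa> j x + \<kappa> j (inv x) = \<kappa> j x + - \<kappa> j x] (mod int p ^ \<alpha> j)"
    using \<kappa>_mult[OF j, of x "inv x"] \<kappa>_one[OF j] x by (simp add: cong_def)
  then have "[\<kappa> j (inv x) = - \<kappa> j x] (mod int p ^ \<alpha> j)" using cong_add_lcancel by blast
  then show ?thesis using \<kappa>_mod[OF j, of "inv x"] x by (simp add: cong_def)
qed

lemma generate_e_ker: "generate G (e ` J \<union> ker) = carrier G"
proof
  have sub: "e ` J \<union> ker \<subseteq> carrier G" using e_closed by (auto simp: ker_def)
  then show le: "generate G (e ` J \<union> ker) \<subseteq> carrier G" by (rule generate_incl)
  show "carrier G \<subseteq> generate G (e ` J \<union> ker)"
  proof
    fix x assume x: "x \<in> carrier G"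
    have "\<exists>y\<in>generate G (e ` J \<union> ker). \<forall>j\<in>J. \<kappa> j y = (if j \<in> I then \<kappa> j x else 0)"
      if "finite I" "I \<subseteq> J" for I
      using that
    proof (induction I)
      case empty
      show ?case using \<kappa>_one by (intro bexI[of _ \<one>]) (auto intro: generate.one)
    next
      case (insert i I)
      then obtain y where y: "y \<in> generate G (e ` J \<union> ker)"
        "\<And>j. j \<in> J \<Longrightarrow> \<kappa> j y = (if j \<in> I then \<kappa> j x else 0)" by auto
      have i: "i \<in> J" "e i \<in> carrier G" using insert e_closed by auto
      define z where "z = e i [^] nat (\<kappa> i x)"
      have pow: "e i [^] n \<in> generate G (e ` J \<union> ker)" for n :: nat
        using i by (induction n) (auto intro: generate.one generate.eng generate.incl)
      have yz: "y \<in> carrier G" "z \<in> carrier G" using y(1) le i by (auto simp: z_def)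
      have "\<kappa> j z = (if j = i then \<kappa> i x else 0)" if "j \<in> J" for j
        using \<kappa>_pow[OF that i(2), of "nat (\<kappa> i x)"] \<kappa>_e[OF i(1) that] \<kappa>_range[OF i(1) x]
        by (auto simp: z_def)
      then have "\<kappa> j (y \<otimes> z) = (if j \<in> insert i I then \<kappa> j x else 0)" if "j \<in> J" for j
        using \<kappa>_mult[OF that yz] y(2)[OF that] that \<kappa>_mod[OF that x] insert.hyps by auto
      then show ?case using y(1) pow[of "nat (\<kappa> i x)"] unfolding z_def by (meson generate.eng)
    qed
    from this[OF finite_J order_refl] obtain y where y: "y \<in> generate G (e ` J \<union> ker)"
      "\<And>j. j \<in> J \<Longrightarrow> \<kappa> j y = \<kappa> j x" by auto
    have yc: "y \<in> carrier G" using y le by auto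
    have "\<kappa> j (x \<otimes> inv y) = 0" if "j \<in> J" for j
      using \<kappa>_mult[OF that x, of "inv y"] \<kappa>_inv[OF that yc] y(2)[OF that] yc by (simp add: mod_add_right_eq)
    then have "x \<otimes> inv y \<in> generate G (e ` J \<union> ker)"
      using x yc by (intro generate.incl) (simp add: ker_def)
    then have "x \<otimes> inv y \<otimes> y \<in> generate G (e ` J \<union> ker)" using y(1) by (rule generate.eng)
    then show "x \<in> generate G (e ` J \<union> ker)" using x yc by (simp add: m_assoc)
  qed
qed

lemma exists_coordinate_neq_0:
  assumes "x \<in> carrier G" "x [^] (p ^ k) = \<one>" "x \<noteq> \<one>"
  shows "\<exists>j\<in>J. \<kappa> j x \<noteq> 0"
proof (rule ccontr)
  assume "\<not> ?thesis"
  then obtain l :: nat where l: "\<not> p dvd l" "x [^] l = \<one>" using \<kappa>_ker assms(1) by blast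
  have "coprime (p ^ k) l" using l(1) prime prime_imp_coprime by auto
  then show False using eq_one_if_coprime_pow assms l by blast
qed

text \<open>An element of order \<open>p\<close> must have a nonzero coordinate.\<close>

lemma J_nonempty:
  assumes "finite (carrier G)" "p dvd order G"
  shows "J \<noteq> {}"
proof -
  obtain m where "order G = p ^ 1 * m" using assms(2) by (auto simp: dvd_def)
  then obtain H where H: "subgroup H G" "card H = p"
    using sylow_thm[OF prime is_group _ assms(1)] by (metis power_one_right)
  interpret H: subgroup H G by (rule H)
  have "H \<noteq> {\<one>}" using H(2) prime prime_gt_1_nat[OF prime] by auto
  then obtain x where x: "x \<in> H" "x \<noteq> \<one>" using H.one_closed by blast
  interpret HG: group "G\<lparr>carrier := H\<rparr>" using H.subgroup_is_group is_group by blast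
  have "x [^]\<^bsub>G\<lparr>carrier := H\<rparr>\<^esub> order (G\<lparr>carrier := H\<rparr>) = \<one>"
    using HG.pow_order_eq_1[of x] x by simp
  then have "x [^] p = \<one>" using H(2) by (simp add: Coset.order_def nat_pow_def)
  then show ?thesis using exists_coordinate_neq_0[of x 1] x H.subset by auto
qed

end

text \<open>Write the order of \<open>G\<close> as \<open>p\<^sup>a c\<close> with \<open>p\<close> not dividing \<open>c\<close>. If \<open>t\<close> is a multiple of \<open>c\<close>
  that is congruent to 1 modulo \<open>p\<^sup>a\<close>, then \<open>x \<mapsto> x\<^sup>t\<close> is the projection of \<open>G\<close> onto its
  \<open>p\<close>-primary component.\<close>

lemma (in comm_group) primary_coordinates_exist:
  fixes q \<alpha> :: "'i \<Rightarrow> nat"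
  assumes fin: "finite (carrier G)" and p: "prime p" and J: "finite J"
    and q: "\<And>j. j \<in> J \<Longrightarrow> q j = p ^ \<alpha> j" "\<And>j. j \<in> J \<Longrightarrow> q j > 1"
    and iso: "primary_component G p \<cong> product_group J (\<lambda>j. integer_mod_group (q j))"
  obtains e \<kappa> where "primary_coordinates G p J \<alpha> e \<kappa>"
proof -
  let ?Q = "product_group J (\<lambda>j. integer_mod_group (q j))"
  define H where "H = {x \<in> carrier G. \<exists>k::nat. x [^] (p ^ k) = \<one>}"
  have pc: "primary_component G p = G\<lparr>carrier := H\<rparr>" by (simp add: primary_component_def H_def)
  have q0: "q j \<noteq> 0" if "j \<in> J" for j using q(2)[OF that] by simp
  have carQ: "carrier ?Q = (\<Pi>\<^sub>E j\<in>J. {0..<int (q j)})"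
    unfolding carrier_product_group by (intro PiE_cong) (use q0 in \<open>simp add: carrier_integer_mod_group\<close>)
  obtain \<psi> where bij: "bij_betw \<psi> H (carrier ?Q)"
    and hom: "\<And>x y. x \<in> H \<Longrightarrow> y \<in> H \<Longrightarrow> \<psi> (x \<otimes> y) = \<psi> x \<otimes>\<^bsub>?Q\<^esub> \<psi> y"
    using iso unfolding is_iso_def iso_def hom_def pc by auto
  have p1: "p > 1" using p prime_gt_1_nat by blast
  have "order G > 0" using fin order_gt_0_iff_finite by blast
  then obtain a c where ac: "order G = p ^ a * c" "\<not> p dvd c"
    using p by (metis multiplicity_decompose' not_less_zero not_prime_unit neq0_conv)
  \<comment> \<open>The exponent \<open>a + 1\<close> instead of \<open>a\<close> ensures that \<open>p\<close> does not divide \<open>t\<close> even if \<open>a = 0\<close>.\<close>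
  have "coprime c (p ^ (a + 1))" using ac(2) p by (metis coprime_commute coprime_power_left_iff prime_imp_coprime)
  then obtain u where u: "[c * u = 1] (mod p ^ (a + 1))" using cong_solve_coprime_nat by (metis One_nat_def)
  define t where "t = c * u"
  have t: "[t = 1] (mod p ^ a)" "\<not> p dvd t"
  proof -
    show "[t = 1] (mod p ^ a)" using u unfolding t_def by (rule cong_dvd_modulus_nat) simp
    have "[t = 1] (mod p)" using u unfolding t_def by (rule cong_dvd_modulus_nat) simp
    then show "\<not> p dvd t" using p1 by (metis cong_dvd_iff nat_dvd_1_iff_1 less_irrefl)
  qed
  have tH: "x [^] t \<in> H" if x: "x \<in> carrier G" for x
  proof -
    have "(x [^] t) [^] (p ^ a) = x [^] (order G * u)"
      using x by (simp add: nat_pow_pow t_def ac(1) mult_ac)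
    also have "\<dots> = \<one>" using x by (simp add: pow_order_eq_1 flip: nat_pow_pow)
    finally show ?thesis using x by (auto simp: H_def)
  qed
  have tid: "x [^] t = x" if x: "x \<in> H" for x
  proof -
    obtain k where k: "x [^] (p ^ k) = \<one>" and xc: "x \<in> carrier G" using x by (auto simp: H_def)
    have "ord x dvd p ^ k" using k xc pow_eq_id by blast
    then have "coprime (ord x) c" using ac(2) p
      by (metis coprime_divisors coprime_power_left_iff dvd_refl prime_imp_coprime)
    moreover have "ord x dvd p ^ a * c" using xc ac(1) ord_dvd_group_order by metis
    ultimately have "ord x dvd p ^ a" by (simp add: coprime_dvd_mult_left_iff)
    then have "[t = 1] (mod ord x)" using t(1) cong_dvd_modulus_nat by blast
    then have "int (ord x) dvd int t - int 1" by (metis cong_iff_dvd_diff cong_int_iff)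
    then have "x [^] int 1 = x [^] int t" using xc int_pow_eq by blast
    then show ?thesis using xc by (simp add: int_pow_int)
  qed
  define e where "e i = inv_into H \<psi> (\<lambda>j\<in>J. if j = i then 1 else 0)" for i
  define \<kappa> where "\<kappa> j x = \<psi> (x [^] t) j" for j x
  have unit: "(\<lambda>j\<in>J. if j = i then 1 else 0) \<in> carrier ?Q" for i
    unfolding carQ using q(2) q0 by auto
  have eH: "e i \<in> H" and \<psi>e: "\<psi> (e i) = (\<lambda>j\<in>J. if j = i then 1 else 0)" for i
    using bij_betw_inv_into_right[OF bij unit[of i]] inv_into_into[of _ \<psi> H] unit[of i] bij
    unfolding e_def by (auto simp: bij_betw_def)
  have inj: "x = y" if "x \<in> H" "y \<in> H" "\<psi> x = \<psi> y" for x y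
    using bij that by (auto simp: bij_betw_def inj_on_def)
  have oneH: "\<one> \<in> H" by (auto simp: H_def)
  have \<psi>Q: "\<psi> x \<in> (\<Pi>\<^sub>E j\<in>J. {0..<int (q j)})" if "x \<in> H" for x
    using bij that carQ by (auto simp: bij_betw_def)
  have \<psi>mult: "\<psi> (x \<otimes> y) j = (\<psi> x j + \<psi> y j) mod int (q j)" if "x \<in> H" "y \<in> H" "j \<in> J" for x y j
    using that by (simp add: hom)
  have \<psi>one: "\<psi> \<one> j = 0" if j: "j \<in> J" for j
  proof -
    have r: "\<psi> \<one> j \<in> {0..<int (q j)}" using \<psi>Q[OF oneH] j by auto
    have "[\<psi> \<one> j + 0 = \<psi> \<one> j + \<psi> \<one> j] (mod int (q j))"
      using \<psi>mult[OF oneH oneH j] r by (simp add: cong_def)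
    then have "[0 = \<psi> \<one> j] (mod int (q j))" using cong_add_lcancel by blast
    then show ?thesis using r by (simp add: cong_def)
  qed
  have powH: "x [^] n \<in> H" if x: "x \<in> H" for x and n :: nat
  proof -
    obtain k where k: "x [^] (p ^ k) = \<one>" "x \<in> carrier G" using x by (auto simp: H_def)
    have "(x [^] n) [^] (p ^ k) = (x [^] (p ^ k)) [^] n" using k(2) by (simp add: nat_pow_pow mult.commute)
    then show ?thesis using k by (auto simp: H_def)
  qed
  have \<psi>pow: "\<psi> (x [^] n) j = (int n * \<psi> x j) mod int (q j)" if "x \<in> H" "j \<in> J" for x j and n :: nat
  proof (induction n)
    case (Suc n)
    have "x [^] n \<in> H" using that powH by auto
    then show ?case using Suc \<psi>mult[of "x [^] n" x j] that by (simp add: mod_simps algebra_simps)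
  qed (use \<psi>one that in simp)
  have "primary_coordinates G p J \<alpha> e \<kappa>"
  proof unfold_locales
    fix j assume j: "j \<in> J"
    show "\<alpha> j > 0" using q[OF j] by (cases "\<alpha> j") auto
    show "e j \<in> carrier G" using eH by (auto simp: H_def)
    show "e j [^] (p ^ \<alpha> j) = \<one>"
    proof (rule inj)
      show "\<psi> (e j [^] (p ^ \<alpha> j)) = \<psi> \<one>"
      proof (rule PiE_ext[OF \<psi>Q \<psi>Q])
        fix i assume i: "i \<in> J"
        show "\<psi> (e j [^] (p ^ \<alpha> j)) i = \<psi> \<one> i"
          using \<psi>pow[OF eH i, of j "p ^ \<alpha> j"] \<psi>one[OF i] \<psi>e[of j] i q(1) by auto
      qed (use powH eH oneH in auto)
    qed (use powH eH oneH in auto)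
    show "\<kappa> j x \<in> {0..<int p ^ \<alpha> j}" if "x \<in> carrier G" for x
      using PiE_mem[OF \<psi>Q[OF tH[OF that]] j] q(1)[OF j] by (simp add: \<kappa>_def)
    show "\<kappa> j (x \<otimes> y) = (\<kappa> j x + \<kappa> j y) mod int p ^ \<alpha> j"
      if "x \<in> carrier G" "y \<in> carrier G" for x y
      using \<psi>mult[OF tH tH j] that q(1)[OF j] by (simp add: \<kappa>_def nat_pow_distrib)
    show "\<kappa> j (e i) = (if i = j then 1 else 0)" if "i \<in> J" for i
      using \<psi>e[of i] j by (auto simp: \<kappa>_def tid[OF eH])
  next
    fix x assume x: "x \<in> carrier G" "\<And>j. j \<in> J \<Longrightarrow> \<kappa> j x = 0"
    have "x [^] t = \<one>"
    proof (rule inj)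
      show "\<psi> (x [^] t) = \<psi> \<one>"
      proof (rule PiE_ext[OF \<psi>Q \<psi>Q])
        show "\<psi> (x [^] t) i = \<psi> \<one> i" if "i \<in> J" for i
          using x(2)[OF that] \<psi>one[OF that] by (simp add: \<kappa>_def)
      qed (use tH x oneH in auto)
    qed (use tH x oneH in auto)
    then show "\<exists>l::nat. \<not> p dvd l \<and> x [^] l = \<one>" using t(2) by blast
  qed (use p J in auto)
  then show ?thesis by (rule that)
qed

section \<open>Divisibility of iterated differences and its sharpness\<close>

text \<open>The contribution of a single prime, for a domain with factors of order \<open>p ^ \<alpha> j\<close>, largest exponent \<open>a\<close>,
  and a codomain of exponent \<open>p ^ b\<close>.\<close>

definition primary_bound :: "nat \<Rightarrow> 'i set \<Rightarrow> ('i \<Rightarrow> nat) \<Rightarrow> nat \<Rightarrow> nat \<Rightarrow> nat" where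
  "primary_bound p J \<alpha> a b = (\<Sum>j\<in>J. p ^ \<alpha> j - 1) + (b - 1) * ((p - 1) * p ^ (a - 1))"


context primary_coordinates
begin

text \<open>The exponent of \<open>p\<close> that \<open>d\<close> differences along \<open>e j\<close> are guaranteed to produce: the first
  factor \<open>p\<close> takes \<open>p ^ \<alpha> j\<close> of them, and each further one takes \<open>(p - 1) * p ^ (\<alpha> j - 1)\<close>.\<close>

definition gain :: "'i \<Rightarrow> nat \<Rightarrow> nat" where
  "gain j d = (if d < p ^ \<alpha> j then 0 else 1 + (d - p ^ \<alpha> j) div ((p - 1) * p ^ (\<alpha> j - 1)))"

lemma step_pos: "(p - 1) * p ^ a > 0"
  using prime_gt_1_nat[OF prime] by simp

lemma power_\<alpha>: "j \<in> J \<Longrightarrow> p ^ \<alpha> j = p * p ^ (\<alpha> j - 1)"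
  using \<alpha>_pos by (metis Suc_diff_1 power_Suc)

lemma e_pow': "j \<in> J \<Longrightarrow> e j [^] (p * p ^ (\<alpha> j - 1)) = \<one>"
  using e_pow power_\<alpha> by metis

lemma gain_dvd:
  assumes "j \<in> J" "x \<in> carrier G"
  shows "int p ^ gain j d dvd idiffs G (replicate d (e j)) F x"
proof (cases "d < p ^ \<alpha> j")
  case False
  let ?s = "(p - 1) * p ^ (\<alpha> j - 1)"
  let ?k = "(d - p ^ \<alpha> j) div ?s"
  have "?k * ?s \<le> d - p ^ \<alpha> j" by simp
  then have "p * p ^ (\<alpha> j - 1) + ?k * ?s \<le> d" using False power_\<alpha>[OF assms(1)] by linarith
  from dvd_idiffs_replicate[OF prime e_closed[OF assms(1)] e_pow'[OF assms(1)] assms(2) this]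
  show ?thesis using False by (simp add: gain_def)
qed (simp add: gain_def)

lemma gain_ge:
  assumes "\<alpha> j \<le> a"
  shows "d \<le> (p ^ \<alpha> j - 1) + gain j d * ((p - 1) * p ^ (a - 1))"
proof (cases "d < p ^ \<alpha> j")
  case False
  let ?s = "(p - 1) * p ^ (\<alpha> j - 1)"
  have "d - p ^ \<alpha> j < gain j d * ?s"
    using False step_pos[of "\<alpha> j - 1"] by (simp add: gain_def dividend_less_div_times)
  also have "\<dots> \<le> gain j d * ((p - 1) * p ^ (a - 1))"
    using assms prime_gt_1_nat[OF prime] by (intro mult_le_mono power_increasing) auto
  finally show ?thesis using False by linarith
qed simp

lemma gains_dvd:
  assumes "finite I" "I \<subseteq> J" "set js \<subseteq> I" "x \<in> carrier G"
  shows "int p ^ (\<Sum>j\<in>I. gain j (count_list js j)) dvd idiffs G (map e js) F x"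
  using assms
proof (induction I arbitrary: js F)
  case (insert i I)
  define c js' where "c = count_list js i" and "js' = filter (\<lambda>j. j \<noteq> i) js"
  define P where "P = int p ^ gain i c"
  define F' where "F' y = idiffs G (replicate c (e i)) F y div P" for y
  have i: "i \<in> J" "e i \<in> carrier G" using insert.prems e_closed by auto
  have js': "set js' \<subseteq> I" using insert.prems by (auto simp: js'_def)
  have ejs: "set (map e js) \<subseteq> carrier G" "set (map e js') \<subseteq> carrier G"
    using insert.prems e_closed js' by auto
  have "mset js = mset (filter (\<lambda>j. j \<noteq> i) js) + mset (replicate (count_list js i) i)"
    by (induction js) auto
  then have "mset js = mset js' + mset (replicate c i)" by (simp only: js'_def c_def)
  then have m: "mset (map e js) = mset (map e js' @ replicate c (e i))"
    by (metis image_mset_union map_replicate mset_append mset_map)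
  have cnt: "count_list js' j = count_list js j" if "j \<in> I" for j
  proof -
    have "j \<noteq> i" using that insert.hyps by auto
    then show ?thesis unfolding js'_def by (induction js) auto
  qed
  have "idiffs G (map e js) F x = idiffs G (map e js') (idiffs G (replicate c (e i)) F) x"
    using idiffs_mset[OF m ejs(1)] insert.prems by (simp add: idiffs_append)
  also have "\<dots> = idiffs G (map e js') (\<lambda>y. P * F' y) x"
    using gain_dvd[OF i(1)] ejs insert.prems by (intro idiffs_cong) (simp_all add: F'_def P_def)
  also have "\<dots> = P * idiffs G (map e js') F' x" by (rule idiffs_mult_left)
  finally have eq: "idiffs G (map e js) F x = P * idiffs G (map e js') F' x" .
  have "int p ^ (\<Sum>j\<in>I. gain j (count_list js' j)) dvd idiffs G (map e js') F' x"
    using insert.prems js' by (intro insert.IH) auto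
  then have "P * int p ^ (\<Sum>j\<in>I. gain j (count_list js j)) dvd idiffs G (map e js) F x"
    unfolding eq using cnt by (simp add: mult_dvd_mono)
  then show ?case using insert.hyps by (simp add: P_def c_def power_add)
qed simp

text \<open>Only differences along the \<open>e j\<close> matter, as those along the kernel of the coordinates give 0. If
  \<open>e j\<close> is used \<open>d\<^sub>j\<close> times, then \<open>d\<^sub>j\<close> is at most \<open>p ^ \<alpha> j - 1\<close> plus the gain times the largest
  step \<open>(p - 1) * p ^ (a - 1)\<close>. Summing over \<open>j\<close>, a total gain below \<open>b\<close> would allow at
  most \<open>primary_bound p J \<alpha> a b\<close> differences.\<close>

lemma dvd_idiffs_if_length_gt_bound:
  assumes F: "\<And>x k. x \<in> carrier G \<Longrightarrow> k \<in> ker \<Longrightarrow> F (x \<otimes> k) = F x"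
    and a: "\<And>j. j \<in> J \<Longrightarrow> \<alpha> j \<le> a"
    and len: "length gs > primary_bound p J \<alpha> a b" and gs: "set gs \<subseteq> carrier G" and x: "x \<in> carrier G"
  shows "int p ^ b dvd idiffs G gs F x"
proof (rule idiffs_dvd_generate[OF generate_e_ker _ _ refl gs x])
  show "e ` J \<union> ker \<subseteq> carrier G" using e_closed by (auto simp: ker_def)
next
  fix hs y assume hs: "length hs = length gs" "set hs \<subseteq> e ` J \<union> ker" and y: "y \<in> carrier G"
  have hsc: "set hs \<subseteq> carrier G" using hs(2) e_closed by (auto simp: ker_def)
  show "int p ^ b dvd idiffs G hs F y"
  proof (cases "\<exists>g\<in>set hs. g \<in> ker")
    case True
    then obtain g where "g \<in> set hs" "g \<in> ker" by blast
    then have "idiffs G hs F y = 0" using F hsc y by (intro idiffs_eq_0_if_periodic[of F g]) auto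
    then show ?thesis by simp
  next
    case False
    then have "hs \<in> lists (e ` J)" using hs(2) by auto
    then obtain js where js: "js \<in> lists J" "hs = map e js" by (metis imageE lists_image)
    let ?M = "(p - 1) * p ^ (a - 1)"
    let ?K = "\<Sum>j\<in>J. gain j (count_list js j)"
    have "length hs = (\<Sum>j\<in>J. count_list js j)"
      using js sum_count_set[of js J] finite_J by (simp add: lists_eq_set)
    also have "\<dots> \<le> (\<Sum>j\<in>J. (p ^ \<alpha> j - 1) + gain j (count_list js j) * ?M)"
      by (intro sum_mono gain_ge a)
    also have "\<dots> = (\<Sum>j\<in>J. p ^ \<alpha> j - 1) + ?K * ?M"
      by (simp only: sum.distrib sum_distrib_right)
    finally have "(b - 1) * ?M < ?K * ?M" using len hs(1) unfolding primary_bound_def by linarith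
    then have "b - 1 < ?K" by simp
    then have "b \<le> ?K" by linarith
    moreover have "int p ^ ?K dvd idiffs G (map e js) F y"
      using js y finite_J by (intro gains_dvd) (auto simp: lists_eq_set)
    ultimately show ?thesis using js(2) by (metis dvd_trans le_imp_power_dvd)
  qed
qed

text \<open>The indicator of the subgroup on which all coordinates outside \<open>I\<close> vanish. Starting from the
  indicator of the kernel of the coordinates, summation along \<open>e i\<close> adds \<open>i\<close> to \<open>I\<close> and ends
  with the constant 1, whose values are prime to \<open>p\<close>.\<close>

definition slice :: "'i set \<Rightarrow> 'a \<Rightarrow> int" where
  "slice I x = (if \<forall>j\<in>J - I. \<kappa> j x = 0 then 1 else 0)"

lemma slice_ker:
  assumes "x \<in> carrier G" "k \<in> ker"
  shows "slice I (x \<otimes> k) = slice I x"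
proof -
  have "\<kappa> j (x \<otimes> k) = \<kappa> j x" if "j \<in> J" for j
    using \<kappa>_mult[OF that assms(1), of k] \<kappa>_mod[OF that assms(1)] that assms(2) by (simp add: ker_def)
  then show ?thesis by (simp add: slice_def)
qed

lemma sum_slice:
  assumes i: "i \<in> J" "i \<notin> I" and x: "x \<in> carrier G"
  shows "(\<Sum>n<p ^ \<alpha> i. slice I (x \<otimes> e i [^] n)) = slice (insert i I) x"
proof -
  let ?q = "p ^ \<alpha> i"
  have q: "?q > 0" using prime_gt_0_nat[OF prime] by simp
  have \<kappa>: "\<kappa> j (x \<otimes> e i [^] n) = (if j = i then (\<kappa> i x + int n) mod int ?q else \<kappa> j x)"
    if j: "j \<in> J" for j n
    using \<kappa>_mult[OF j x, of "e i [^] n"] \<kappa>_pow[OF j e_closed[OF i(1)], of n] \<kappa>_e[OF i(1) j]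
      \<kappa>_mod[OF j x] e_closed[OF i(1)] by (auto simp: mod_simps)
  \<comment> \<open>Exactly one of the translates has its \<open>i\<close>-th coordinate equal to 0.\<close>
  define m where "m = nat ((- \<kappa> i x) mod int ?q)"
  have m: "m < ?q" "int m = (- \<kappa> i x) mod int ?q" using q by (simp_all add: m_def nat_less_iff)
  have zero: "(\<kappa> i x + int n) mod int ?q = 0 \<longleftrightarrow> n = m" if "n < ?q" for n
  proof -
    have "(\<kappa> i x + int n) mod int ?q = 0 \<longleftrightarrow> [int n = - \<kappa> i x] (mod int ?q)"
      by (simp add: cong_iff_dvd_diff mod_eq_0_iff_dvd add.commute)
    also have "\<dots> \<longleftrightarrow> int n = int m" using that m by (simp add: cong_def)
    finally show ?thesis by simp
  qed
  have "slice I (x \<otimes> e i [^] n) = (if n = m then slice (insert i I) x else 0)" if "n < ?q" for n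
  proof -
    have "(\<forall>j\<in>J - I. \<kappa> j (x \<otimes> e i [^] n) = 0) \<longleftrightarrow> n = m \<and> (\<forall>j\<in>J - insert i I. \<kappa> j x = 0)"
      using \<kappa> zero[OF that] i by auto
    then show ?thesis by (auto simp: slice_def)
  qed
  then have "(\<Sum>n<?q. slice I (x \<otimes> e i [^] n)) = (\<Sum>n<?q. if n = m then slice (insert i I) x else 0)"
    by (intro sum.cong) auto
  also have "\<dots> = slice (insert i I) x" using m(1) by simp
  finally show ?thesis .
qed

text \<open>Modulo \<open>p\<close>, differencing \<open>p ^ \<alpha> j - 1\<close> times along \<open>e j\<close> is the same as summing along \<open>e j\<close>.\<close>

lemma idiffs_slice_cong:
  assumes "distinct js" "set js \<subseteq> J" "x \<in> carrier G"
  shows "[idiffs G (concat (map (\<lambda>j. replicate (p ^ \<alpha> j - 1) (e j)) js)) (slice {}) x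
           = slice (set js) x] (mod int p)"
  using assms
proof (induction js arbitrary: x)
  case (Cons i js)
  let ?R = "replicate (p ^ \<alpha> i - 1) (e i)"
  let ?F = "idiffs G (concat (map (\<lambda>j. replicate (p ^ \<alpha> j - 1) (e j)) js)) (slice {})"
  have i: "i \<in> J" "e i \<in> carrier G" "i \<notin> set js" using Cons.prems e_closed by auto
  have "[idiffs G ?R ?F x = idiffs G ?R (slice (set js)) x] (mod int p)"
    using Cons i by (intro idiffs_cong_mod) auto
  also have "[idiffs G ?R (slice (set js)) x = (\<Sum>n<p ^ \<alpha> i. slice (set js) (x \<otimes> e i [^] n))] (mod int p)"
    using idiffs_replicate_cong[OF prime i(2) e_pow'[OF i(1)] Cons.prems(3), of 0 "slice (set js)"]
    by (simp add: power_\<alpha>[OF i(1)])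
  also have "(\<Sum>n<p ^ \<alpha> i. slice (set js) (x \<otimes> e i [^] n)) = slice (set (i # js)) x"
    using sum_slice[OF i(1,3) Cons.prems(3)] by simp
  finally show ?case by (simp add: idiffs_append)
qed simp

text \<open>The bound is sharp because the length of the list is exactly the number of differences for which
  each passage above is lossless: in a direction \<open>i\<close> of largest order all \<open>k\<close> further factors \<open>- p\<close>
  are produced, and the other directions only sum modulo \<open>p\<close>.\<close>

lemma sharp_idiffs_slice:
  assumes i: "i \<in> J" and x: "x \<in> carrier G"
  obtains gs where "set gs \<subseteq> carrier G" "length gs = primary_bound p J \<alpha> (\<alpha> i) (Suc k)"
    "[idiffs G gs (slice {}) x = (-1) ^ k * int p ^ k] (mod int p ^ Suc k)"
proof -
  obtain js where js: "set js = J - {i}" "distinct js" using finite_J finite_distinct_list by blast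
  define hs where "hs = concat (map (\<lambda>j. replicate (p ^ \<alpha> j - 1) (e j)) js)"
  define d where "d = p * p ^ (\<alpha> i - 1) - 1 + k * ((p - 1) * p ^ (\<alpha> i - 1))"
  let ?H = "idiffs G hs (slice {})"
  have hs: "set hs \<subseteq> carrier G" using js e_closed by (auto simp: hs_def)
  have len: "length hs = (\<Sum>j\<in>J - {i}. p ^ \<alpha> j - 1)"
    using js by (simp add: hs_def length_concat comp_def sum_list_distinct_conv_sum_set)
  have ec: "e i \<in> carrier G" using e_closed i by simp
  have H: "[?H y = slice (J - {i}) y] (mod int p)" if "y \<in> carrier G" for y
    using idiffs_slice_cong[of js y] js that by (simp add: hs_def)
  have 1: "[idiffs G (replicate d (e i)) ?H x = (-1) ^ k * int p ^ k *
      (\<Sum>n<p * p ^ (\<alpha> i - 1). ?H (x \<otimes> e i [^] n))] (mod int p ^ (k + 1))"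
    unfolding d_def by (rule idiffs_replicate_cong[OF prime ec e_pow'[OF i] x])
  have 2: "[(-1) ^ k * int p ^ k * (\<Sum>n<p * p ^ (\<alpha> i - 1). ?H (x \<otimes> e i [^] n))
      = (-1) ^ k * int p ^ k * 1] (mod int p ^ (k + 1))"
  proof -
    have "[(\<Sum>n<p * p ^ (\<alpha> i - 1). ?H (x \<otimes> e i [^] n)) =
        (\<Sum>n<p ^ \<alpha> i. slice (J - {i}) (x \<otimes> e i [^] n))] (mod int p)"
      unfolding power_\<alpha>[OF i] using x ec by (intro cong_sum H) auto
    also have "(\<Sum>n<p ^ \<alpha> i. slice (J - {i}) (x \<otimes> e i [^] n)) = slice (insert i (J - {i})) x"
      using i x by (intro sum_slice) auto
    also have "\<dots> = 1" using i by (auto simp: slice_def)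
    finally obtain z where z: "(\<Sum>n<p * p ^ (\<alpha> i - 1). ?H (x \<otimes> e i [^] n)) - 1 = int p * z"
      by (auto simp: cong_iff_dvd_diff dvd_def)
    have "(-1) ^ k * int p ^ k * (\<Sum>n<p * p ^ (\<alpha> i - 1). ?H (x \<otimes> e i [^] n)) - (-1) ^ k * int p ^ k * 1
       = (-1) ^ k * int p ^ k * (int p * z)"
      unfolding z[symmetric] by (simp only: right_diff_distrib)
    also have "\<dots> = int p ^ (k + 1) * ((-1) ^ k * z)" by simp
    finally show ?thesis by (metis cong_iff_dvd_diff dvd_triv_left)
  qed
  have "[idiffs G (replicate d (e i) @ hs) (slice {}) x = (-1) ^ k * int p ^ k] (mod int p ^ Suc k)"
    using cong_trans[OF 1 2] by (simp add: idiffs_append)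
  moreover have "length (replicate d (e i) @ hs) = primary_bound p J \<alpha> (\<alpha> i) (Suc k)"
    using finite_J i by (simp add: len d_def primary_bound_def sum.remove[of J i] power_\<alpha>[OF i])
  moreover have "set (replicate d (e i) @ hs) \<subseteq> carrier G"
    using hs ec by (auto simp: set_replicate_conv_if)
  ultimately show ?thesis using that by blast
qed

end

section \<open>Functions between commutative groups\<close>

lemma iter_diff_op_Nil [simp]: "iter_diff_op A B [] f = f"
  and iter_diff_op_Cons: "iter_diff_op A B (g # gs) f = diff_op A B g (iter_diff_op A B gs f)"
  by (simp_all add: iter_diff_op_def)

lemma iter_diff_op_append: "iter_diff_op A B (gs @ hs) f = iter_diff_op A B gs (iter_diff_op A B hs f)"
  by (simp add: iter_diff_op_def)

locale comm_group_pair = A: comm_group A + B: comm_group B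
  for A :: "('a, 'm) monoid_scheme" and B :: "('b, 'n) monoid_scheme"
begin

lemma iter_diff_op_closed:
  assumes "f \<in> carrier A \<rightarrow> carrier B" "set gs \<subseteq> carrier A" "x \<in> carrier A"
  shows "iter_diff_op A B gs f x \<in> carrier B"
  using assms by (induction gs arbitrary: x) (auto simp: iter_diff_op_Cons diff_op_def)

lemma iter_diff_op_one:
  assumes "\<And>x. x \<in> carrier A \<Longrightarrow> f x = \<one>\<^bsub>B\<^esub>" "set gs \<subseteq> carrier A" "x \<in> carrier A"
  shows "iter_diff_op A B gs f x = \<one>\<^bsub>B\<^esub>"
  using assms by (induction gs arbitrary: x) (auto simp: iter_diff_op_Cons diff_op_def)

lemma diffs_vanish_Suc:
  assumes "diffs_vanish A B f k" shows "diffs_vanish A B f (Suc k)"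
  unfolding diffs_vanish_def
proof (intro allI impI ballI)
  fix gs x assume gs: "length gs = Suc k \<and> set gs \<subseteq> carrier A" and x: "x \<in> carrier A"
  then obtain g hs where "gs = g # hs" by (cases gs) auto
  then show "iter_diff_op A B gs f x = \<one>\<^bsub>B\<^esub>"
    using assms gs x unfolding diffs_vanish_def by (simp add: iter_diff_op_Cons diff_op_def)
qed

lemma diffs_vanish_mono:
  assumes "diffs_vanish A B f k" "k \<le> l" shows "diffs_vanish A B f l"
  using assms(2,1) by (induction rule: dec_induct) (auto intro: diffs_vanish_Suc)

text \<open>A homomorphism to the integers modulo \<open>c\<close>, given by representatives, carries differences in \<open>B\<close>
  to differences of integers modulo \<open>c\<close>.\<close>

lemma iter_diff_op_idiffs_cong:
  assumes \<phi>: "\<And>y z. y \<in> carrier B \<Longrightarrow> z \<in> carrier B \<Longrightarrow> [\<phi> (y \<otimes>\<^bsub>B\<^esub> z) = \<phi> y + \<phi> z] (mod c)"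
    and f: "f \<in> carrier A \<rightarrow> carrier B" and gs: "set gs \<subseteq> carrier A" and x: "x \<in> carrier A"
  shows "[\<phi> (iter_diff_op A B gs f x) = idiffs A gs (\<lambda>x. \<phi> (f x)) x] (mod c)"
  using gs x
proof (induction gs arbitrary: x)
  case (Cons g gs)
  let ?u = "iter_diff_op A B gs f (x \<otimes>\<^bsub>A\<^esub> g)" and ?v = "iter_diff_op A B gs f x"
  have B: "?u \<in> carrier B" "?v \<in> carrier B" using Cons.prems f by (simp_all add: iter_diff_op_closed)
  have "[\<phi> (?u \<otimes>\<^bsub>B\<^esub> inv\<^bsub>B\<^esub> ?v \<otimes>\<^bsub>B\<^esub> ?v) = \<phi> (?u \<otimes>\<^bsub>B\<^esub> inv\<^bsub>B\<^esub> ?v) + \<phi> ?v] (mod c)"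
    using B by (intro \<phi>) auto
  then have "[\<phi> (?u \<otimes>\<^bsub>B\<^esub> inv\<^bsub>B\<^esub> ?v) = \<phi> ?u - \<phi> ?v] (mod c)"
    using B by (simp add: B.m_assoc cong_iff_dvd_diff) (metis diff_diff_eq diff_minus_eq_add dvd_minus_iff minus_diff_eq add.commute diff_add_eq)
  also have "[\<phi> ?u - \<phi> ?v = idiffs A gs (\<lambda>x. \<phi> (f x)) (x \<otimes>\<^bsub>A\<^esub> g) - idiffs A gs (\<lambda>x. \<phi> (f x)) x] (mod c)"
    using Cons by (intro cong_diff) auto
  finally show ?case by (simp add: iter_diff_op_Cons diff_op_def idiffs_Cons idiff_def)
qed simp

lemma iter_diff_op_int_pow:
  assumes "b \<in> carrier B"
  shows "iter_diff_op A B gs (\<lambda>x. b [^]\<^bsub>B\<^esub> F x) x = b [^]\<^bsub>B\<^esub> idiffs A gs F x"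
  by (induction gs arbitrary: x)
     (simp_all add: iter_diff_op_Cons diff_op_def idiffs_Cons idiff_def B.int_pow_diff assms)

lemma iter_diff_op_nat_pow:
  assumes f: "f \<in> carrier A \<rightarrow> carrier B" and gs: "set gs \<subseteq> carrier A" and x: "x \<in> carrier A"
  shows "iter_diff_op A B gs (\<lambda>x. f x [^]\<^bsub>B\<^esub> (c::nat)) x = iter_diff_op A B gs f x [^]\<^bsub>B\<^esub> c"
  using gs x
proof (induction gs arbitrary: x)
  case (Cons g gs)
  then show ?case using f
    by (simp add: iter_diff_op_Cons diff_op_def iter_diff_op_closed B.nat_pow_distrib B.nat_pow_inv)
qed simp

text \<open>If the second difference of a function along \<open>g\<close> vanishes, the function is affine along \<open>g\<close>: its
  value at \<open>x g\<^sup>i\<close> is \<open>w d\<^sup>i\<close>. Returning to \<open>x\<close> at \<open>i = l\<close> forces \<open>d\<^sup>l = 1\<close>, so \<open>d\<close> is trivial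
  as its order divides both \<open>l\<close> and a power of \<open>p\<close>. Applied to iterated differences of \<open>h\<close>, this
  lowers the order of vanishing down to 1. Finiteness of the functional degree enters the upper
  bound through this lemma.\<close>

lemma translation_invariant_if_coprime_order:
  fixes l :: nat
  assumes h: "h \<in> carrier A \<rightarrow> carrier B" and p: "prime p"
    and tor: "\<And>x. x \<in> carrier A \<Longrightarrow> h x [^]\<^bsub>B\<^esub> (p ^ k) = \<one>\<^bsub>B\<^esub>"
    and van: "diffs_vanish A B h (Suc m)"
    and g: "g \<in> carrier A" "g [^]\<^bsub>A\<^esub> l = \<one>\<^bsub>A\<^esub>" "\<not> p dvd l" and x: "x \<in> carrier A"
  shows "h (x \<otimes>\<^bsub>A\<^esub> g) = h x"
proof -
  define W where "W j = iter_diff_op A B (replicate j g) h" for j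
  have sub: "set (replicate j g) \<subseteq> carrier A" for j using g(1) by (auto simp: set_replicate_conv_if)
  have W: "W j y \<in> carrier B" if "y \<in> carrier A" for j y
    unfolding W_def using iter_diff_op_closed[OF h sub that] .
  have W_Suc: "W (Suc j) y = W j (y \<otimes>\<^bsub>A\<^esub> g) \<otimes>\<^bsub>B\<^esub> inv\<^bsub>B\<^esub> W j y" for j y
    by (simp add: W_def iter_diff_op_Cons diff_op_def)
  have step: "W (Suc j) (y \<otimes>\<^bsub>A\<^esub> g) = W (Suc j) y" "W j (y \<otimes>\<^bsub>A\<^esub> g) = W j y \<otimes>\<^bsub>B\<^esub> W (Suc j) y"
    if "y \<in> carrier A" "W (Suc (Suc j)) y = \<one>\<^bsub>B\<^esub>" for j y
  proof -
    show "W (Suc j) (y \<otimes>\<^bsub>A\<^esub> g) = W (Suc j) y"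
      using that W g(1) unfolding W_Suc[of "Suc j"] by (metis A.m_closed B.inv_closed B.inv_equality B.inv_inv)
    show "W j (y \<otimes>\<^bsub>A\<^esub> g) = W j y \<otimes>\<^bsub>B\<^esub> W (Suc j) y"
      using that(1) W[of y j] W[of "y \<otimes>\<^bsub>A\<^esub> g" j] g(1) unfolding W_Suc[of j]
      by (simp add: B.m_ac B.r_inv) (metis B.inv_closed B.m_assoc B.m_comm B.r_inv B.r_one)
  qed
  have down: "W (Suc j) y = \<one>\<^bsub>B\<^esub>"
    if vanish: "\<And>y. y \<in> carrier A \<Longrightarrow> W (Suc (Suc j)) y = \<one>\<^bsub>B\<^esub>" and y: "y \<in> carrier A" for j y
  proof -
    let ?D = "W (Suc j) y"
    have D: "?D \<in> carrier B" using W y by simp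
    have yi: "y \<otimes>\<^bsub>A\<^esub> g [^]\<^bsub>A\<^esub> Suc i = (y \<otimes>\<^bsub>A\<^esub> g [^]\<^bsub>A\<^esub> i) \<otimes>\<^bsub>A\<^esub> g" for i :: nat
      using y g(1) by (simp add: A.m_assoc)
    have yc: "y \<otimes>\<^bsub>A\<^esub> g [^]\<^bsub>A\<^esub> i \<in> carrier A" for i :: nat using y g(1) by simp
    have const: "W (Suc j) (y \<otimes>\<^bsub>A\<^esub> g [^]\<^bsub>A\<^esub> i) = ?D" for i :: nat
    proof (induction i)
      case (Suc i)
      then show ?case unfolding yi using step(1)[OF yc vanish[OF yc]] by simp
    qed (use y in simp)
    have lin: "W j (y \<otimes>\<^bsub>A\<^esub> g [^]\<^bsub>A\<^esub> i) = W j y \<otimes>\<^bsub>B\<^esub> ?D [^]\<^bsub>B\<^esub> i" for i :: nat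
    proof (induction i)
      case (Suc i)
      then show ?case unfolding yi using step(2)[OF yc vanish[OF yc], of i] W[OF y] D
        by (simp add: const B.m_assoc)
    qed (use y W in simp)
    have "W j y \<otimes>\<^bsub>B\<^esub> ?D [^]\<^bsub>B\<^esub> l = W j y" using lin[of l] g y by simp
    then have "?D [^]\<^bsub>B\<^esub> l = \<one>\<^bsub>B\<^esub>"
      using W[OF y, of j] D by (metis B.l_cancel_one' B.nat_pow_closed)
    moreover have "?D [^]\<^bsub>B\<^esub> (p ^ k) = \<one>\<^bsub>B\<^esub>"
    proof -
      have "iter_diff_op A B (replicate (Suc j) g) (\<lambda>x. h x [^]\<^bsub>B\<^esub> (p ^ k)) y = \<one>\<^bsub>B\<^esub>"
        by (rule iter_diff_op_one[OF _ sub y]) (rule tor)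
      then show ?thesis
        using iter_diff_op_nat_pow[OF h sub y, of "Suc j" "p ^ k"] by (simp only: W_def)
    qed
    moreover have "coprime (p ^ k) l" using g(3) p prime_imp_coprime by auto
    ultimately show ?thesis using D B.eq_one_if_coprime_pow by blast
  qed
  have "\<forall>y\<in>carrier A. W (Suc m) y = \<one>\<^bsub>B\<^esub>"
    using van sub[of "Suc m"] unfolding diffs_vanish_def W_def by simp
  then have "\<forall>y\<in>carrier A. W (Suc 0) y = \<one>\<^bsub>B\<^esub>"
  proof (induction m)
    case (Suc m)
    show ?case by (rule Suc.IH) (use down Suc.prems in blast)
  qed simp
  then have "W 0 (x \<otimes>\<^bsub>A\<^esub> g) \<otimes>\<^bsub>B\<^esub> inv\<^bsub>B\<^esub> W 0 x = \<one>\<^bsub>B\<^esub>" using W_Suc x by simp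
  then have "W 0 (x \<otimes>\<^bsub>A\<^esub> g) = W 0 x"
    using W x g(1) by (metis A.m_closed B.inv_closed B.inv_equality B.inv_inv)
  then show ?thesis by (simp add: W_def)
qed

text \<open>If a value \<open>y\<close> of the \<open>D + 1\<close>-fold differences is nontrivial, some prime \<open>p\<close> divides its order.
  Raising \<open>f\<close> to the \<open>p\<close>-free part \<open>c\<close> of the order of \<open>B\<close> projects to the \<open>p\<close>-primary component
  while keeping the value nontrivial, and makes \<open>f\<close> invariant under elements of order prime to \<open>p\<close>.
  If \<open>p\<close> does not divide the order of \<open>A\<close>, the power is constant; otherwise one of its coordinates
  contradicts the bound for integer functions.\<close>

lemma diffs_vanish_if_primary_bounds:
  assumes finB: "finite (carrier B)" and finA: "finite (carrier A)"
    and f: "f \<in> carrier A \<rightarrow> carrier B" and van: "diffs_vanish A B f (Suc N)"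
    and loc: "\<And>p. prime p \<Longrightarrow> p dvd order A \<Longrightarrow> p dvd order B \<Longrightarrow>
       \<exists>(J::'i set) \<alpha> e \<kappa> (J'::'j set) \<beta> e' \<kappa>' a b.
         primary_coordinates A p J \<alpha> e \<kappa> \<and> primary_coordinates B p J' \<beta> e' \<kappa>' \<and>
         (\<forall>j\<in>J. \<alpha> j \<le> a) \<and> (\<forall>j\<in>J'. \<beta> j \<le> b) \<and> primary_bound p J \<alpha> a b \<le> D"
  shows "diffs_vanish A B f (Suc D)"
  unfolding diffs_vanish_def
proof (intro allI impI ballI, rule ccontr)
  fix gs x assume gs: "length gs = Suc D \<and> set gs \<subseteq> carrier A" and x: "x \<in> carrier A"
    and ne: "iter_diff_op A B gs f x \<noteq> \<one>\<^bsub>B\<^esub>"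
  define y where "y = iter_diff_op A B gs f x"
  have y: "y \<in> carrier B" unfolding y_def using iter_diff_op_closed f gs x by blast
  have "B.ord y \<noteq> 1" using y ne B.ord_eq_1 y_def by blast
  then obtain p where p: "prime p" "p dvd B.ord y" using prime_factor_nat by blast
  have pB: "p dvd order B" using p(2) B.ord_dvd_group_order[OF y] by (rule dvd_trans)
  have "order B > 0" using finB B.order_gt_0_iff_finite by blast
  then obtain k c where kc: "order B = p ^ k * c" "\<not> p dvd c"
    using p(1) by (metis multiplicity_decompose' not_less_zero not_prime_unit neq0_conv)
  define h where "h x = f x [^]\<^bsub>B\<^esub> c" for x
  have h: "h \<in> carrier A \<rightarrow> carrier B" using f by (auto simp: h_def intro!: B.nat_pow_closed)
  have htor: "h z [^]\<^bsub>B\<^esub> (p ^ k) = \<one>\<^bsub>B\<^esub>" if "z \<in> carrier A" for z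
  proof -
    have "f z \<in> carrier B" using f that by blast
    then show ?thesis
      using B.pow_order_eq_1[of "f z"] by (simp add: h_def B.nat_pow_pow kc(1) mult.commute)
  qed
  have hy: "iter_diff_op A B us h z = iter_diff_op A B us f z [^]\<^bsub>B\<^esub> c"
    if "set us \<subseteq> carrier A" "z \<in> carrier A" for us z
    unfolding h_def by (rule iter_diff_op_nat_pow[OF f that])
  have van_h: "diffs_vanish A B h (Suc N)"
    using van unfolding diffs_vanish_def by (auto simp: hy)
  define b where "b = iter_diff_op A B gs h x"
  have b: "b = y [^]\<^bsub>B\<^esub> c" "b \<in> carrier B" using hy gs x y by (auto simp: b_def y_def)
  have b1: "b \<noteq> \<one>\<^bsub>B\<^esub>"
    using p(2) kc(2) b(1) y B.pow_eq_id dvd_trans by metis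
  have btor: "b [^]\<^bsub>B\<^esub> (p ^ k) = \<one>\<^bsub>B\<^esub>"
    using B.pow_order_eq_1[OF y] y by (simp add: b(1) B.nat_pow_pow kc(1) mult.commute)
  have inv: "h (z \<otimes>\<^bsub>A\<^esub> g) = h z"
    if "z \<in> carrier A" "g \<in> carrier A" "g [^]\<^bsub>A\<^esub> l = \<one>\<^bsub>A\<^esub>" "\<not> p dvd l" for z g and l :: nat
    using translation_invariant_if_coprime_order[OF h p(1) htor van_h that(2-4,1)] .
  show False
  proof (cases "p dvd order A")
    case False
    obtain us g where us: "gs = us @ [g]" using gs by (metis length_Suc_conv_rev)
    have "diff_op A B g h z = \<one>\<^bsub>B\<^esub>" if "z \<in> carrier A" for z
    proof -
      have "g \<in> carrier A" using gs us by auto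
      then have "h (z \<otimes>\<^bsub>A\<^esub> g) = h z" using inv[OF that, of g "order A"] A.pow_order_eq_1 False by blast
      moreover have "h z \<in> carrier B" using h that by blast
      ultimately show ?thesis by (simp add: diff_op_def)
    qed
    then have "b = \<one>\<^bsub>B\<^esub>"
      unfolding b_def us iter_diff_op_append iter_diff_op_Cons iter_diff_op_Nil
      using gs us x by (intro iter_diff_op_one) auto
    with b1 show False by simp
  next
    case True
    obtain J :: "'i set" and \<alpha> e \<kappa> and J' :: "'j set" and \<beta> e' \<kappa>' am bm where
      P: "primary_coordinates A p J \<alpha> e \<kappa>" and Q: "primary_coordinates B p J' \<beta> e' \<kappa>'"
      and le: "\<And>j. j \<in> J \<Longrightarrow> \<alpha> j \<le> am" "\<And>j. j \<in> J' \<Longrightarrow> \<beta> j \<le> bm" "primary_bound p J \<alpha> am bm \<le> D"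
      using loc[OF p(1) True pB] by blast
    interpret P: primary_coordinates A p J \<alpha> e \<kappa> by (rule P)
    interpret Q: primary_coordinates B p J' \<beta> e' \<kappa>' by (rule Q)
    obtain j where j: "j \<in> J'" "\<kappa>' j b \<noteq> 0" using Q.exists_coordinate_neq_0[OF b(2) btor b1] by blast
    have "int p ^ bm dvd idiffs A gs (\<lambda>x. \<kappa>' j (h x)) x"
    proof (rule P.dvd_idiffs_if_length_gt_bound[OF _ le(1)])
      fix z g assume z: "z \<in> carrier A" and g: "g \<in> P.ker"
      then obtain l :: nat where "\<not> p dvd l" "g [^]\<^bsub>A\<^esub> l = \<one>\<^bsub>A\<^esub>" 
        using P.\<kappa>_ker[of g] by (auto simp: P.ker_def)
      then show "\<kappa>' j (h (z \<otimes>\<^bsub>A\<^esub> g)) = \<kappa>' j (h z)" using inv z g by (simp add: P.ker_def)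
    qed (use le gs x in auto)
    then have "int p ^ \<beta> j dvd idiffs A gs (\<lambda>x. \<kappa>' j (h x)) x"
      using le(2)[OF j(1)] le_imp_power_dvd dvd_trans by blast
    moreover have "[\<kappa>' j b = idiffs A gs (\<lambda>x. \<kappa>' j (h x)) x] (mod int p ^ \<beta> j)"
      unfolding b_def using gs x h
      by (intro iter_diff_op_idiffs_cong) (auto simp: Q.\<kappa>_mult[OF j(1)] cong_def)
    ultimately have "int p ^ \<beta> j dvd \<kappa>' j b" using cong_dvd_iff cong_sym by (metis cong_dvd_modulus cong_0_iff cong_trans)
    then show False using j Q.\<kappa>_mod[OF j(1) b(2)] by (simp add: dvd_eq_mod_eq_0)
  qed
qed

text \<open>A function supported on the elements of \<open>A\<close> of order prime to \<open>p\<close>, where it takes a constant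
  value of order \<open>p ^ \<beta> j\<close>, attains the bound. Among all functions on the \<open>p\<close>-primary component the
  indicator of a point detects most, because every function is a combination of its translates.\<close>

lemma primary_bound_attained:
  assumes P: "primary_coordinates A p (J::'i set) \<alpha> e \<kappa>" and Q: "primary_coordinates B p (J'::'j set) \<beta> e' \<kappa>'"
    and i: "i \<in> J" "\<And>j. j \<in> J \<Longrightarrow> \<alpha> j \<le> \<alpha> i" and j: "j \<in> J'"
  obtains f where "f \<in> carrier A \<rightarrow> carrier B" "fdeg A B f = enat (primary_bound p J \<alpha> (\<alpha> i) (\<beta> j))"
proof -
  interpret P: primary_coordinates A p J \<alpha> e \<kappa> by (rule P)
  interpret Q: primary_coordinates B p J' \<beta> e' \<kappa>' by (rule Q)
  let ?D = "primary_bound p J \<alpha> (\<alpha> i) (\<beta> j)"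
  define f where "f x = e' j [^]\<^bsub>B\<^esub> P.slice {} x" for x
  have ej: "e' j \<in> carrier B" using Q.e_closed j by simp
  have f: "f \<in> carrier A \<rightarrow> carrier B" using ej by (auto simp: f_def)
  have up: "diffs_vanish A B f (Suc ?D)"
    unfolding diffs_vanish_def
  proof (intro allI impI ballI)
    fix gs x assume gs: "length gs = Suc ?D \<and> set gs \<subseteq> carrier A" and x: "x \<in> carrier A"
    have "int p ^ \<beta> j dvd idiffs A gs (P.slice {}) x"
      using gs x P.slice_ker by (intro P.dvd_idiffs_if_length_gt_bound[OF _ i(2)]) auto
    then obtain z where "idiffs A gs (P.slice {}) x = int (p ^ \<beta> j) * z" by (auto simp: dvd_def)
    then show "iter_diff_op A B gs f x = \<one>\<^bsub>B\<^esub>"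
      unfolding f_def iter_diff_op_int_pow[OF ej] using ej Q.e_pow[OF j]
      by (metis B.int_pow_one B.int_pow_pow int_pow_int)
  qed
  have low: "\<not> diffs_vanish A B f ?D"
  proof
    assume v: "diffs_vanish A B f ?D"
    have \<beta>: "Suc (\<beta> j - 1) = \<beta> j" using Q.\<alpha>_pos[OF j] by simp
    obtain gs where gs: "set gs \<subseteq> carrier A" "length gs = ?D"
      "[idiffs A gs (P.slice {}) \<one>\<^bsub>A\<^esub> = (-1) ^ (\<beta> j - 1) * int p ^ (\<beta> j - 1)] (mod int p ^ \<beta> j)"
      using P.sharp_idiffs_slice[OF i(1) A.one_closed, of "\<beta> j - 1"] unfolding \<beta> by blast
    have "\<kappa>' j (f x) = P.slice {} x" for x
      using Q.\<kappa>_e[OF j j] Q.\<kappa>_one[OF j] ej by (simp add: f_def P.slice_def)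
    then have "[\<kappa>' j (iter_diff_op A B gs f \<one>\<^bsub>A\<^esub>) = idiffs A gs (P.slice {}) \<one>\<^bsub>A\<^esub>] (mod int p ^ \<beta> j)"
      using iter_diff_op_idiffs_cong[of "\<kappa>' j" "int p ^ \<beta> j" f gs "\<one>\<^bsub>A\<^esub>"] f gs(1)
      by (simp add: Q.\<kappa>_mult[OF j])
    moreover have "iter_diff_op A B gs f \<one>\<^bsub>A\<^esub> = \<one>\<^bsub>B\<^esub>"
      using v gs unfolding diffs_vanish_def by simp
    ultimately have "[0 = (-1) ^ (\<beta> j - 1) * int p ^ (\<beta> j - 1)] (mod int p ^ \<beta> j)"
      using gs(3) Q.\<kappa>_one[OF j] cong_trans by metis
    then have "int p ^ \<beta> j dvd (-1) ^ (\<beta> j - 1) * int p ^ (\<beta> j - 1)"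
      using cong_0_iff cong_sym by blast
    then have "int p ^ \<beta> j dvd int p ^ (\<beta> j - 1)"
      by (cases "even (\<beta> j - 1)") simp_all
    then have "p ^ \<beta> j dvd p ^ (\<beta> j - 1)" by (metis of_nat_dvd_iff of_nat_power)
    then have "\<beta> j \<le> \<beta> j - 1" using prime_gt_1_nat[OF P.prime] power_dvd_imp_le by blast
    then show False using \<beta> by simp
  qed
  have "(LEAST m. diffs_vanish A B f (m + 1)) = ?D"
  proof (rule Least_equality)
    show "?D \<le> m" if "diffs_vanish A B f (m + 1)" for m
      using low diffs_vanish_mono[OF that, of ?D] by (metis Suc_eq_plus1 not_less_eq_eq)
  qed (use up in simp)
  then have "fdeg A B f = enat ?D" using up unfolding fdeg_def by (metis Suc_eq_plus1)
  with f show ?thesis by (rule that)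
qed

end

section \<open>The largest functional degree\<close>

theorem theorem5p3:
  fixes A :: "('a, 'm) monoid_scheme" and B :: "('b, 'n) monoid_scheme"
    and s :: nat and p :: "nat \<Rightarrow> nat"
    and n m :: "nat \<Rightarrow> nat" and q r \<alpha> \<beta> :: "nat \<Rightarrow> nat \<Rightarrow> nat"
    and \<alpha>max \<beta>max :: "nat \<Rightarrow> nat" and bound :: nat
  assumes "comm_group A" and "finite (carrier A)"
    and "comm_group B" and "finite (carrier B)"
    and "gcd (order A) (order B) > 1"
    and "bij_betw p {1..s} (prime_factors (gcd (order A) (order B)))"
    and "\<And>i j. i \<in> {1..s} \<Longrightarrow> j \<in> {1..n i} \<Longrightarrow> q i j = p i ^ \<alpha> i j \<and> q i j > 1"
    and "\<And>i. i \<in> {1..s} \<Longrightarrow>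
           primary_component A (p i) \<cong> product_group {1..n i} (\<lambda>j. integer_mod_group (q i j))"
    and "\<And>i j. i \<in> {1..s} \<Longrightarrow> j \<in> {1..m i} \<Longrightarrow> r i j = p i ^ \<beta> i j \<and> r i j > 1"
    and "\<And>i. i \<in> {1..s} \<Longrightarrow>
           primary_component B (p i) \<cong> product_group {1..m i} (\<lambda>j. integer_mod_group (r i j))"
    and "\<And>i. i \<in> {1..s} \<Longrightarrow> \<alpha>max i = Max (\<alpha> i ` {1..n i})"
    and "\<And>i. i \<in> {1..s} \<Longrightarrow> \<beta>max i = Max (\<beta> i ` {1..m i})"
    and "bound = Max ((\<lambda>i. (\<Sum>j=1..n i. p i ^ \<alpha> i j) - n i
                         + (\<beta>max i - 1) * (p i - 1) * p i ^ (\<alpha>max i - 1)) ` {1..s})"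
  shows "(\<forall>f \<in> carrier A \<rightarrow> carrier B. fdeg A B f \<noteq> \<infinity> \<longrightarrow> fdeg A B f \<le> enat bound) \<and>
         (\<exists>f \<in> carrier A \<rightarrow> carrier B. fdeg A B f \<noteq> \<infinity> \<and> fdeg A B f = enat bound)"
proof -
  interpret A: comm_group A by (rule assms(1))
  interpret B: comm_group B by (rule assms(3))
  interpret comm_group_pair A B by unfold_locales
  define I where "I = {1..s}"
  define D where "D i = primary_bound (p i) {1..n i} (\<alpha> i) (\<alpha>max i) (\<beta>max i)" for i
  have p_image: "p ` I = prime_factors (gcd (order A) (order B))"
    using assms(6) by (simp add: bij_betw_def I_def)
  have p: "prime (p i)" "p i dvd order A" "p i dvd order B" if "i \<in> I" for i
  proof -
    have "p i \<in> prime_factors (gcd (order A) (order B))" using p_image that by blast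
    then show "prime (p i)" "p i dvd order A" "p i dvd order B"
      using in_prime_factors_imp_dvd by auto
  qed
  have "I \<noteq> {}"
  proof -
    obtain r where "prime r" "r dvd gcd (order A) (order B)"
      using assms(5) prime_factor_nat by (metis less_irrefl)
    then have "r \<in> prime_factors (gcd (order A) (order B))"
      using assms(5) by (intro prime_factorsI) auto
    then show ?thesis using p_image by blast
  qed
  have coordA: "\<exists>e \<kappa>. primary_coordinates A (p i) {1..n i} (\<alpha> i) e \<kappa>" if i: "i \<in> I" for i
    using A.primary_coordinates_exist[OF assms(2) p(1)[OF i], of "{1..n i}" "q i" "\<alpha> i"]
      assms(7,8) i unfolding I_def by (metis finite_atLeastAtMost)
  have coordB: "\<exists>e \<kappa>. primary_coordinates B (p i) {1..m i} (\<beta> i) e \<kappa>" if i: "i \<in> I" for i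
    using B.primary_coordinates_exist[OF assms(4) p(1)[OF i], of "{1..m i}" "r i" "\<beta> i"]
      assms(9,10) i unfolding I_def by (metis finite_atLeastAtMost)
  have \<alpha>max: "\<alpha> i j \<le> \<alpha>max i" if "i \<in> I" "j \<in> {1..n i}" for i j
    using assms(11)[of i] that by (simp add: I_def)
  have \<beta>max: "\<beta> i j \<le> \<beta>max i" if "i \<in> I" "j \<in> {1..m i}" for i j
    using assms(12)[of i] that by (simp add: I_def)
  have D: "(\<Sum>j=1..n i. p i ^ \<alpha> i j) - n i + (\<beta>max i - 1) * (p i - 1) * p i ^ (\<alpha>max i - 1) = D i"
    if i: "i \<in> I" for i
  proof -
    have "(\<Sum>j=1..n i. p i ^ \<alpha> i j - 1) = (\<Sum>j=1..n i. p i ^ \<alpha> i j) - (\<Sum>j=1..n i. 1)"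
      using prime_gt_0_nat[OF p(1)[OF i]] by (intro sum_subtractf_nat) (simp add: Suc_leI)
    then show ?thesis by (simp add: D_def primary_bound_def mult.assoc)
  qed
  have bound: "bound = Max (D ` I)"
    unfolding assms(13) I_def[symmetric] by (intro arg_cong[of _ _ Max] image_cong refl D)
  have fin: "finite (D ` I)" "D ` I \<noteq> {}" using \<open>I \<noteq> {}\<close> by (simp_all add: I_def)
  have upper: "fdeg A B f \<le> enat bound" if f: "f \<in> carrier A \<rightarrow> carrier B" "fdeg A B f \<noteq> \<infinity>" for f
  proof -
    obtain N where N: "diffs_vanish A B f (Suc N)" using f(2) by (auto simp: fdeg_def split: if_splits)
    have "diffs_vanish A B f (Suc bound)"
    proof (rule diffs_vanish_if_primary_bounds[OF assms(4,2) f(1) N])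
      fix r assume r: "prime r" "r dvd order A" "r dvd order B"
      have "r \<in> prime_factors (gcd (order A) (order B))"
        using r assms(5) by (intro prime_factorsI) auto
      then obtain i where i: "i \<in> I" "r = p i" using p_image by blast
      have "D i \<le> bound" unfolding bound using fin i(1) by (intro Max_ge) auto
      moreover obtain e \<kappa> where "primary_coordinates A (p i) {1..n i} (\<alpha> i) e \<kappa>"
        using coordA[OF i(1)] by blast
      moreover obtain e' \<kappa>' where "primary_coordinates B (p i) {1..m i} (\<beta> i) e' \<kappa>'"
        using coordB[OF i(1)] by blast
      ultimately show "\<exists>(J::nat set) \<alpha> e \<kappa> (J'::nat set) \<beta> e' \<kappa>' a b.
         primary_coordinates A r J \<alpha> e \<kappa> \<and> primary_coordinates B r J' \<beta> e' \<kappa>' \<and>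
         (\<forall>j\<in>J. \<alpha> j \<le> a) \<and> (\<forall>j\<in>J'. \<beta> j \<le> b) \<and> primary_bound r J \<alpha> a b \<le> bound"
        using \<alpha>max[OF i(1)] \<beta>max[OF i(1)] unfolding i(2) D_def by blast
    qed
    then have "diffs_vanish A B f (bound + 1)" by simp
    then show ?thesis unfolding fdeg_def by (auto intro: Least_le)
  qed
  moreover have "\<exists>f \<in> carrier A \<rightarrow> carrier B. fdeg A B f = enat bound"
  proof -
    obtain i where i: "i \<in> I" "bound = D i" using Max_in[OF fin] unfolding bound by blast
    obtain e \<kappa> where P: "primary_coordinates A (p i) {1..n i} (\<alpha> i) e \<kappa>" using coordA[OF i(1)] by blast
    obtain e' \<kappa>' where Q: "primary_coordinates B (p i) {1..m i} (\<beta> i) e' \<kappa>'" using coordB[OF i(1)] by blast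
    have ne: "{1..n i} \<noteq> {}" "{1..m i} \<noteq> {}"
      using primary_coordinates.J_nonempty[OF P assms(2) p(2)[OF i(1)]]
        primary_coordinates.J_nonempty[OF Q assms(4) p(3)[OF i(1)]] by auto
    have "i \<in> {1..s}" using i(1) by (simp add: I_def)
    note max_eqs = assms(11,12)[OF this]
    have "Max (\<alpha> i ` {1..n i}) \<in> \<alpha> i ` {1..n i}" "Max (\<beta> i ` {1..m i}) \<in> \<beta> i ` {1..m i}"
      by (rule Max_in; use ne in simp)+
    then have "\<alpha>max i \<in> \<alpha> i ` {1..n i}" "\<beta>max i \<in> \<beta> i ` {1..m i}"
      unfolding max_eqs .
    then obtain j k where j: "j \<in> {1..n i}" "\<alpha>max i = \<alpha> i j" and k: "k \<in> {1..m i}" "\<beta>max i = \<beta> i k"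
      by blast
    from primary_bound_attained[OF P Q j(1) _ k(1)] \<alpha>max[OF i(1)]
    show ?thesis unfolding i(2) D_def j(2) k(2) by metis
  qed
  ultimately show ?thesis by force
qed

end
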